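(* Let $n\ge 3$ and let $w=\sum_{1\le i<k\le n} w_{ik}\,(ik)\in\mathbb{C}S_n$ with $w_{ik}\in\mathbb{R}$, $w_{ik}\ge 0$ for all $i<k$, and with $w_{1n}+w_{2n}+\cdots+w_{n-1,n}>0$. Let $$\theta(w)=\sum_{1\le i<k\le n-1}\left[w_{ik}+\frac{w_{in}\,w_{kn}}{w_{1n}+\cdots+w_{n-1,n}}\right](ik)\in\mathbb{C}S_{n-1}\subset\mathbb{C}S_n .$$ Then $w-\theta(w)\in\Gamma(S_n)$.
   Context: $S_n$ is the symmetric group on $\{1,\dots,n\}$, $(ik)$ denotes the transposition exchanging $i$ and $k$, and $S_{n-1}$ is regarded as the subgroup of $S_n$ of permutations fixing $n$. For a finite group $G$ with complex group algebra $\mathbb{C}G$, an element $w=\sum_{g\in G}w_g\,g$ is called symmetric if $w=w^*$, where $w^*:=\sum_{g}\overline{w_g}\,g^{-1}$; the set of symmetric elements is denoted $\mathbb{C}G^{(s)}$. For a finite-dimensional complex representation $R$ of $G$ on $V$, the representation Laplacian is the linear operator on $V$ $$\Delta_G(w,R):=\sum_{g\in G}w_g\,[\mathrm{id}_V-R(g)].$$ Representations are realized as unitary representations (with respect to a suitable inner product on $V$), so that $\Delta_G(w,R)$ is self-adjoint for $w\in\mathbb{C}G^{(s)}$. For a self-adjoint operator $A$, $A\ge0$ means that $\langle A\cdot,\cdot\rangle$ is positive semidefinite. One sets $$\Gamma(G):=\{w\in\mathbb{C}G^{(s)}:\ \Delta_G(w,T)\ge 0\ \text{ for every irreducible complex representation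 } T \text{ of } G\},$$ equivalently, the set of $w\in\mathbb{C}G^{(s)}$ with $\Delta_G(w,L)\ge0$, where $L$ is the left regular representation. *)

theory Defs
  imports
    "HOL-Algebra.Sym_Groups"
    "HOL-Combinatorics.Transposition"
    "HOL-Library.Poly_Mapping"
    "Jordan_Normal_Form.VS_Connect"
begin

section \<open>Group algebra\<close>

text \<open>An element \<open>\<Sum>\<^sub>g w\<^sub>g g\<close> of the complex group algebra of a finite group \<open>G\<close> is the finitely
  supported map \<open>g \<mapsto> w\<^sub>g\<close>; the element \<open>c g\<close> is \<open>Poly_Mapping.single g c\<close>.\<close>

definition group_algebra :: "('g, 'm) monoid_scheme \<Rightarrow> ('g \<Rightarrow>\<^sub>0 complex) set" where
  "group_algebra G = {w. Poly_Mapping.keys w \<subseteq> carrier G}"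

definition star :: "('g, 'm) monoid_scheme \<Rightarrow> ('g \<Rightarrow>\<^sub>0 complex) \<Rightarrow> ('g \<Rightarrow>\<^sub>0 complex)" where
  "star G w = (\<Sum>g\<in>carrier G. Poly_Mapping.single (inv\<^bsub>G\<^esub> g) (cnj (Poly_Mapping.lookup w g)))"

definition symmetric_elements :: "('g, 'm) monoid_scheme \<Rightarrow> ('g \<Rightarrow>\<^sub>0 complex) set" where
  "symmetric_elements G = {w \<in> group_algebra G. star G w = w}"

section \<open>Representations\<close>

text \<open>Finite-dimensional complex representations, up to isomorphism: homomorphisms into
  the invertible \<open>d \<times> d\<close> matrices, acting on \<open>carrier_vec d\<close>.\<close>

definition complex_rep ::
    "('g, 'm) monoid_scheme \<Rightarrow> nat \<Rightarrow> ('g \<Rightarrow> complex mat) \<Rightarrow> bool" where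
  "complex_rep G d R \<longleftrightarrow> R \<in> hom G (units_of (ring_mat TYPE(complex) d ()))"

definition irreducible_rep ::
    "('g, 'm) monoid_scheme \<Rightarrow> nat \<Rightarrow> ('g \<Rightarrow> complex mat) \<Rightarrow> bool" where
  "irreducible_rep G d R \<longleftrightarrow> complex_rep G d R \<and> d > 0 \<and>
     (\<forall>W. VectorSpace.subspace class_ring W (module_vec TYPE(complex) d) \<longrightarrow>
          (\<forall>g\<in>carrier G. \<forall>x\<in>W. R g *\<^sub>v x \<in> W) \<longrightarrow>
          W = {0\<^sub>v d} \<or> W = carrier_vec d)"

text \<open>Inequalities between complex numbers, here and below, are those of \<open>Complex_Order\<close>:
  \<open>0 \<le> z\<close> entails that \<open>z\<close> is real.\<close>

definition inner_product_on :: "nat \<Rightarrow> (complex vec \<Rightarrow> complex vec \<Rightarrow> complex) \<Rightarrow> bool" where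
  "inner_product_on d ip \<longleftrightarrow>
     (\<forall>x\<in>carrier_vec d. \<forall>y\<in>carrier_vec d. \<forall>z\<in>carrier_vec d. ip (x + y) z = ip x z + ip y z) \<and>
     (\<forall>c. \<forall>x\<in>carrier_vec d. \<forall>y\<in>carrier_vec d. ip (c \<cdot>\<^sub>v x) y = c * ip x y) \<and>
     (\<forall>x\<in>carrier_vec d. \<forall>y\<in>carrier_vec d. ip y x = cnj (ip x y)) \<and>
     (\<forall>x\<in>carrier_vec d. x \<noteq> 0\<^sub>v d \<longrightarrow> 0 < ip x x)"

definition unitary_rep_wrt ::
    "('g, 'm) monoid_scheme \<Rightarrow> nat \<Rightarrow> (complex vec \<Rightarrow> complex vec \<Rightarrow> complex) \<Rightarrow>
     ('g \<Rightarrow> complex mat) \<Rightarrow> bool" where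
  "unitary_rep_wrt G d ip R \<longleftrightarrow>
     (\<forall>g\<in>carrier G. \<forall>x\<in>carrier_vec d. \<forall>y\<in>carrier_vec d. ip (R g *\<^sub>v x) (R g *\<^sub>v y) = ip x y)"

definition psd_wrt ::
    "nat \<Rightarrow> (complex vec \<Rightarrow> complex vec \<Rightarrow> complex) \<Rightarrow> complex mat \<Rightarrow> bool" where
  "psd_wrt d ip A \<longleftrightarrow>
     (\<forall>x\<in>carrier_vec d. \<forall>y\<in>carrier_vec d. ip (A *\<^sub>v x) y = ip x (A *\<^sub>v y)) \<and>
     (\<forall>x\<in>carrier_vec d. 0 \<le> ip (A *\<^sub>v x) x)"

definition rep_laplacian ::
    "('g, 'm) monoid_scheme \<Rightarrow> nat \<Rightarrow> ('g \<Rightarrow>\<^sub>0 complex) \<Rightarrow> ('g \<Rightarrow> complex mat) \<Rightarrow> complex mat" where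
  "rep_laplacian G d w R =
     (\<Oplus>\<^bsub>module_mat TYPE(complex) d d\<^esub> g\<in>carrier G. Poly_Mapping.lookup w g \<cdot>\<^sub>m (1\<^sub>m d - R g))"

text \<open>Positivity is demanded for every inner product that makes \<open>T\<close> unitary. Such inner products
  exist (\<open>ex_invariant_inner_product\<close> below) and, \<open>T\<close> being irreducible, are unique up to a positive
  factor, so the condition does not depend on the choice.\<close>

definition Gamma :: "('g, 'm) monoid_scheme \<Rightarrow> ('g \<Rightarrow>\<^sub>0 complex) set" where
  "Gamma G = {w \<in> symmetric_elements G.
     \<forall>d T ip. irreducible_rep G d T \<longrightarrow> inner_product_on d ip \<longrightarrow> unitary_rep_wrt G d ip T \<longrightarrow>
       psd_wrt d ip (rep_laplacian G d w T)}"

lemma complex_repD: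
  assumes "complex_rep G d R"
  shows "g \<in> carrier G \<Longrightarrow> R g \<in> carrier_mat d d"
    and "g \<in> carrier G \<Longrightarrow> h \<in> carrier G \<Longrightarrow> R (g \<otimes>\<^bsub>G\<^esub> h) = R g * R h"
    and "g \<in> carrier G \<Longrightarrow> x \<in> carrier_vec d \<Longrightarrow> R g *\<^sub>v x = 0\<^sub>v d \<Longrightarrow> x = 0\<^sub>v d"
proof -
  have u: "R g \<in> Units (ring_mat TYPE(complex) d ())" if "g \<in> carrier G" for g
    using assms that by (auto simp: complex_rep_def hom_def units_of_def)
  show c: "R g \<in> carrier_mat d d" if "g \<in> carrier G" for g
    using u[OF that] by (auto simp: Units_def ring_mat_simps)
  show "R (g \<otimes>\<^bsub>G\<^esub> h) = R g * R h" if "g \<in> carrier G" "h \<in> carrier G"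
    using assms that by (auto simp: complex_rep_def hom_def units_of_def ring_mat_simps)
  show "x = 0\<^sub>v d" if g: "g \<in> carrier G" and x: "x \<in> carrier_vec d" and z: "R g *\<^sub>v x = 0\<^sub>v d"
  proof -
    obtain B where B: "B \<in> carrier_mat d d" "B * R g = 1\<^sub>m d"
      using u[OF g] by (auto simp: Units_def ring_mat_simps)
    have "x = (B * R g) *\<^sub>v x" using B x by simp
    also have "\<dots> = B *\<^sub>v (R g *\<^sub>v x)" by (rule assoc_mult_mat_vec[OF B(1) c[OF g] x])
    also have "\<dots> = 0\<^sub>v d" using B z by (auto intro!: eq_vecI)
    finally show ?thesis .
  qed
qed

lemma ex_invariant_inner_product:
  assumes G: "group G" and fin: "finite (carrier G)" and R: "complex_rep G d R"
  shows "\<exists>ip. inner_product_on d ip \<and> unitary_rep_wrt G d ip R"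
proof -
  interpret group G by (rule G)
  define ip where "ip x y = (\<Sum>g\<in>carrier G. (R g *\<^sub>v x) \<bullet>c (R g *\<^sub>v y))" for x y
  note rep = complex_repD[OF R]
  have cv: "R g *\<^sub>v x \<in> carrier_vec d" if "g \<in> carrier G" "x \<in> carrier_vec d" for g x
    using rep(1)[OF that(1)] that(2) by auto
  have add: "ip (x + y) z = ip x z + ip y z"
    if xyz: "x \<in> carrier_vec d" "y \<in> carrier_vec d" "z \<in> carrier_vec d" for x y z
  proof -
    have "(R g *\<^sub>v (x + y)) \<bullet>c (R g *\<^sub>v z)
        = (R g *\<^sub>v x) \<bullet>c (R g *\<^sub>v z) + (R g *\<^sub>v y) \<bullet>c (R g *\<^sub>v z)"
      if g: "g \<in> carrier G" for g
    proof -
      have c: "conjugate (R g *\<^sub>v z) \<in> carrier_vec d" using cv[OF g xyz(3)] by simp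
      show ?thesis
        unfolding mult_add_distrib_mat_vec[OF rep(1)[OF g] xyz(1,2)]
        by (rule add_scalar_prod_distrib[OF cv[OF g xyz(1)] cv[OF g xyz(2)] c])
    qed
    then show ?thesis by (simp add: ip_def sum.distrib)
  qed
  have scale: "ip (c \<cdot>\<^sub>v x) y = c * ip x y"
    if xy: "x \<in> carrier_vec d" "y \<in> carrier_vec d" for c x y
  proof -
    have "(R g *\<^sub>v (c \<cdot>\<^sub>v x)) \<bullet>c (R g *\<^sub>v y) = c * ((R g *\<^sub>v x) \<bullet>c (R g *\<^sub>v y))"
      if g: "g \<in> carrier G" for g
    proof -
      have c: "conjugate (R g *\<^sub>v y) \<in> carrier_vec d" using cv[OF g xy(2)] by simp
      show ?thesis
        unfolding mult_mat_vec[OF rep(1)[OF g] xy(1)]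
        by (rule smult_scalar_prod_distrib[OF cv[OF g xy(1)] c])
    qed
    then show ?thesis by (simp add: ip_def sum_distrib_left)
  qed
  have herm: "ip y x = cnj (ip x y)" if xy: "x \<in> carrier_vec d" "y \<in> carrier_vec d" for x y
  proof -
    have "(R g *\<^sub>v y) \<bullet>c (R g *\<^sub>v x) = cnj ((R g *\<^sub>v x) \<bullet>c (R g *\<^sub>v y))"
      if g: "g \<in> carrier G" for g
      using cv[OF g xy(1)] cv[OF g xy(2)]
      by (auto simp: scalar_prod_def mult.commute intro!: sum.cong)
    then show ?thesis by (simp add: ip_def)
  qed
  have pos: "0 < ip x x" if x: "x \<in> carrier_vec d" "x \<noteq> 0\<^sub>v d" for x
    unfolding ip_def
  proof (rule sum_pos[OF fin])
    show "carrier G \<noteq> {}" by auto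
    show "0 < (R g *\<^sub>v x) \<bullet>c (R g *\<^sub>v x)" if "g \<in> carrier G" for g
      using conjugate_square_greater_0_vec[OF cv[OF that x(1)]] rep(3)[OF that x(1)] x(2) by blast
  qed
  have inv: "ip (R h *\<^sub>v x) (R h *\<^sub>v y) = ip x y"
    if h: "h \<in> carrier G" and xy: "x \<in> carrier_vec d" "y \<in> carrier_vec d" for h x y
  proof -
    have "R g *\<^sub>v (R h *\<^sub>v z) = R (g \<otimes>\<^bsub>G\<^esub> h) *\<^sub>v z"
      if "g \<in> carrier G" "z \<in> carrier_vec d" for g z
      using assoc_mult_mat_vec[OF rep(1)[OF that(1)] rep(1)[OF h] that(2)] rep(2)[OF that(1) h]
      by simp
    then have "ip (R h *\<^sub>v x) (R h *\<^sub>v y)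
        = (\<Sum>g\<in>carrier G. (R (g \<otimes>\<^bsub>G\<^esub> h) *\<^sub>v x) \<bullet>c (R (g \<otimes>\<^bsub>G\<^esub> h) *\<^sub>v y))"
      using xy by (simp add: ip_def)
    also have "\<dots> = ip x y"
      unfolding ip_def
      by (rule sum.reindex_bij_witness[of _ "\<lambda>g. g \<otimes>\<^bsub>G\<^esub> inv\<^bsub>G\<^esub> h" "\<lambda>g. g \<otimes>\<^bsub>G\<^esub> h"])
         (use h in \<open>auto simp: m_assoc\<close>)
    finally show ?thesis .
  qed
  have "inner_product_on d ip"
    unfolding inner_product_on_def by (intro conjI ballI allI impI add scale herm pos)
  moreover have "unitary_rep_wrt G d ip R"
    unfolding unitary_rep_wrt_def by (intro ballI inv)
  ultimately show ?thesis by blast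
qed

section \<open>Weighted sums of transpositions\<close>

text \<open>Permutations of \<open>{1..n}\<close> are functions on \<open>nat\<close> fixing everything outside, so the symmetric
  group on \<open>{1..n - 1}\<close> is literally the stabilizer of \<open>n\<close> in the symmetric group on \<open>{1..n}\<close>, and
  its group algebra is contained in that of the latter. Only the values \<open>c i k\<close> with
  \<open>1 \<le> i < k \<le> n\<close> enter.\<close>

definition transposition_sum :: "nat \<Rightarrow> (nat \<Rightarrow> nat \<Rightarrow> real) \<Rightarrow> ((nat \<Rightarrow> nat) \<Rightarrow>\<^sub>0 complex)" where
  "transposition_sum n c = (\<Sum>(i, k) | 1 \<le> i \<and> i < k \<and> k \<le> n.
     Poly_Mapping.single (Transposition.transpose i k) (complex_of_real (c i k)))"

definition theta :: "nat \<Rightarrow> (nat \<Rightarrow> nat \<Rightarrow> real) \<Rightarrow> ((nat \<Rightarrow> nat) \<Rightarrow>\<^sub>0 complex)" where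
  "theta n w = transposition_sum (n - 1)
     (\<lambda>i k. w i k + w i n * w k n / (\<Sum>j = 1..n - 1. w j n))"

end

theory Submission
  imports "HOL-Analysis.Finite_Function_Topology" "HOL-Analysis.Linear_Algebra" Defs
begin

text \<open>The claim is the octopus inequality of Caputo, Liggett and Richthammer. Write
  \<open>a\<^sub>i = w\<^sub>i\<^sub>n\<close> for \<open>i < n\<close> and let \<open>s\<close> be their sum. The terms \<open>w\<^sub>i\<^sub>k (ik)\<close> with \<open>k < n\<close> cancel in
  \<open>w - \<theta>(w)\<close>. Giving \<open>n\<close> the weight \<open>a\<^sub>n = -s\<close> makes the weights sum to zero and turns \<open>2s\<close> times the
  Laplacian of \<open>w - \<theta>(w)\<close> into the homogeneous expression
  \<open>S = \<Sum>\<^sub>i\<^sub>,\<^sub>k a\<^sub>i a\<^sub>k (ik)\<close>, where \<open>i, k\<close> range over \<open>{1..n}\<close> and \<open>(ii)\<close> is the identity. So \<open>S \<ge> 0\<close> has to be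
  shown, in every unitary representation.

  With \<open>D = \<Sum>\<^sub>i a\<^sub>i\<^sup>2\<close> it is enough that \<open>2DS - S\<^sup>2 \<ge> 0\<close>, because \<open>S\<^sup>2\<close> is positive. Expand \<open>2DS - S\<^sup>2\<close> as a sum over
  quadruples \<open>(i, j, k, l)\<close> with weights \<open>a\<^sub>i a\<^sub>j a\<^sub>k a\<^sub>l\<close>. Since the weights sum to zero, a summand that depends on only
  three of the indices contributes nothing, and modulo such summands (\<open>quartic_identity\<close>) what remains is
  \<open>-2 \<Sum> a\<^sub>i a\<^sub>j a\<^sub>k a\<^sub>l P\<^sub>i\<^sub>j\<^sub>k\<^sub>l\<close> over quadruples of distinct points. Here \<open>P\<^sub>J\<close> is the average over the Klein four-group on
  \<open>J\<close> minus the average over the alternating group on \<open>J\<close>; it is the orthogonal projection onto the component of type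
  \<open>(2,2)\<close>, the two-dimensional irreducible representation of the symmetric group on \<open>J\<close>.

  Only \<open>a\<^sub>n\<close> is negative, so quadruples through \<open>n\<close> help and all others hurt. Writing \<open>s\<close> as the sum of the \<open>a\<^sub>l\<close>
  distributes the first kind over the second, and the comparison is reduced to
  \<open>P\<^sub>J \<le> \<Sum>\<^sub>j\<^sub>\<in>\<^sub>J P\<^sub>J\<^sub>-\<^sub>j\<^sub>+\<^sub>n\<close> for five points (\<open>five_point_inequality\<close>). This holds because the operator on the right
  fixes every vector in the image of \<open>P\<^sub>J\<close> (\<open>five_point_reproducing\<close>).\<close>

section \<open>Weighted sums over quadruples\<close>

definition weighted_sum4 :: "'a set \<Rightarrow> ('a \<Rightarrow> real) \<Rightarrow> ('a \<Rightarrow> 'a \<Rightarrow> 'a \<Rightarrow> 'a \<Rightarrow> real) \<Rightarrow> real" where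
  "weighted_sum4 A a f = (\<Sum>i\<in>A. \<Sum>j\<in>A. \<Sum>k\<in>A. \<Sum>l\<in>A. a i * a j * a k * a l * f i j k l)"

lemma weighted_sum4_linear:
  "weighted_sum4 A a (\<lambda>i j k l. f i j k l + g i j k l) = weighted_sum4 A a f + weighted_sum4 A a g"
  "weighted_sum4 A a (\<lambda>i j k l. f i j k l - g i j k l) = weighted_sum4 A a f - weighted_sum4 A a g"
  "weighted_sum4 A a (\<lambda>i j k l. f i j k l / c) = weighted_sum4 A a f / c"
  by (simp_all add: weighted_sum4_def distrib_left right_diff_distrib sum.distrib sum_subtractf
    flip: sum_divide_distrib)

lemma weighted_sum4_swap:
  "weighted_sum4 A a (\<lambda>i j k l. f j i k l) = weighted_sum4 A a f"
  "weighted_sum4 A a (\<lambda>i j k l. f i k j l) = weighted_sum4 A a f"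
  "weighted_sum4 A a (\<lambda>i j k l. f i j l k) = weighted_sum4 A a f"
proof -
  show "weighted_sum4 A a (\<lambda>i j k l. f j i k l) = weighted_sum4 A a f"
    unfolding weighted_sum4_def by (subst sum.swap) (simp add: mult_ac)
  show "weighted_sum4 A a (\<lambda>i j k l. f i k j l) = weighted_sum4 A a f"
    unfolding weighted_sum4_def
    by (rule sum.cong[OF refl], subst sum.swap) (simp add: mult_ac)
  show "weighted_sum4 A a (\<lambda>i j k l. f i j l k) = weighted_sum4 A a f"
    unfolding weighted_sum4_def
    by (rule sum.cong[OF refl], rule sum.cong[OF refl], subst sum.swap) (simp add: mult_ac)
qed

lemma weighted_sum4_triple:
  "weighted_sum4 A a (\<lambda>i j k l. f i j k) = sum a A * (\<Sum>i\<in>A. \<Sum>j\<in>A. \<Sum>k\<in>A. a i * a j * a k * f i j k)"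
proof -
  have "(\<Sum>l\<in>A. a i * a j * a k * a l * f i j k) = sum a A * (a i * a j * a k * f i j k)" for i j k
    by (simp add: sum_distrib_left sum_distrib_right mult_ac)
  then show ?thesis by (simp add: weighted_sum4_def sum_distrib_left)
qed

text \<open>In particular such a sum vanishes when the weights add up to zero; this is where the choice of the
  weight of the distinguished point enters. With nonnegative weights the same formula is read from right to left,
  to spread a sum over triples evenly over quadruples.\<close>

lemma weighted_sum4_triples:
  "weighted_sum4 A a (\<lambda>i j k l. f i j k + f i j l + f i k l + f j k l)
    = 4 * sum a A * (\<Sum>i\<in>A. \<Sum>j\<in>A. \<Sum>k\<in>A. a i * a j * a k * f i j k)"
proof -
  have 1: "weighted_sum4 A a (\<lambda>i j k l. f i j l) = weighted_sum4 A a (\<lambda>i j k l. f i j k)"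
    by (rule weighted_sum4_swap(3))
  have 2: "weighted_sum4 A a (\<lambda>i j k l. f i k l) = weighted_sum4 A a (\<lambda>i j k l. f i j l)"
    by (rule weighted_sum4_swap(2))
  have 3: "weighted_sum4 A a (\<lambda>i j k l. f j k l) = weighted_sum4 A a (\<lambda>i j k l. f i k l)"
    by (rule weighted_sum4_swap(1))
  show ?thesis by (simp add: weighted_sum4_linear 1 2 3 weighted_sum4_triple)
qed

lemma weighted_sum4_mono:
  assumes "\<And>i. i \<in> A \<Longrightarrow> a i \<ge> 0"
    and "\<And>i j k l. i \<in> A \<Longrightarrow> j \<in> A \<Longrightarrow> k \<in> A \<Longrightarrow> l \<in> A \<Longrightarrow> f i j k l \<le> g i j k l"
  shows "weighted_sum4 A a f \<le> weighted_sum4 A a g"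
  unfolding weighted_sum4_def
  by (intro sum_mono mult_left_mono mult_nonneg_nonneg assms)

text \<open>For a symmetric function supported on quadruples of distinct points, a new point contributes four equal
  terms, one for each position that it can take.\<close>

lemma weighted_sum4_insert:
  assumes fin: "finite A" "p \<notin> A"
    and z: "\<And>i j. f p p i j = 0" "\<And>i j. f p i p j = 0" "\<And>i j. f p i j p = 0"
      "\<And>i j. f i p p j = 0" "\<And>i j. f i p j p = 0" "\<And>i j. f i j p p = 0"
    and s: "\<And>i j k. i \<in> A \<Longrightarrow> j \<in> A \<Longrightarrow> k \<in> A \<Longrightarrow> 
      f i p j k = f p i j k \<and> f i j p k = f p i j k \<and> f i j k p = f p i j k"
  shows "weighted_sum4 (insert p A) a f
    = weighted_sum4 A a f + 4 * a p * (\<Sum>i\<in>A. \<Sum>j\<in>A. \<Sum>k\<in>A. a i * a j * a k * f p i j k)"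
proof -
  have e: "a i * a p * a j * a k * f i p j k = a p * (a i * a j * a k * f p i j k)"
    "a i * a j * a p * a k * f i j p k = a p * (a i * a j * a k * f p i j k)"
    "a i * a j * a k * a p * f i j k p = a p * (a i * a j * a k * f p i j k)"
    "a p * a i * a j * a k * f p i j k = a p * (a i * a j * a k * f p i j k)"
    if "i \<in> A" "j \<in> A" "k \<in> A" for i j k
    using s[OF that] by (simp_all add: mult_ac)
  show ?thesis
    unfolding weighted_sum4_def
    by (simp add: fin z sum.distrib e sum_distrib_left[symmetric] cong: sum.cong_simp)
qed

section \<open>Isometric actions of permutations\<close>

text \<open>The form \<open>B\<close> is only assumed positive semidefinite. Real scalars suffice: in a unitary representation
  the real part of the inner product is such a form, and every coefficient below is real.\<close>

locale isometric_permutation_action =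
  fixes V :: "'a set" and act :: "('a \<Rightarrow> 'a) \<Rightarrow> 'v::real_vector \<Rightarrow> 'v" and B :: "'v \<Rightarrow> 'v \<Rightarrow> real"
  assumes act_linear: "p permutes V \<Longrightarrow> linear (act p)"
    and act_id: "act id x = x"
    and act_comp: "p permutes V \<Longrightarrow> q permutes V \<Longrightarrow> act (p \<circ> q) x = act p (act q x)"
    and B_bilinear: "bilinear B"
    and B_sym: "B x y = B y x"
    and B_nonneg: "B x x \<ge> 0"
    and B_act: "p permutes V \<Longrightarrow> B (act p x) (act p y) = B x y"
begin

lemmas B_simps = bilinear_ladd[OF B_bilinear] bilinear_radd[OF B_bilinear]
  bilinear_lsub[OF B_bilinear] bilinear_rsub[OF B_bilinear]
  bilinear_lmul[OF B_bilinear] bilinear_rmul[OF B_bilinear]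
  bilinear_lzero[OF B_bilinear] bilinear_rzero[OF B_bilinear]

definition tr :: "'a \<Rightarrow> 'a \<Rightarrow> 'v \<Rightarrow> 'v" where
  "tr i k = act (Transposition.transpose i k)"

lemma tr_commute: "tr i k = tr k i"
  by (simp add: tr_def Transposition.transpose_commute)

lemma tr_same: "tr i i x = x"
  by (simp add: tr_def act_id)

lemma transpose_permutes: "i \<in> V \<Longrightarrow> k \<in> V \<Longrightarrow> Transposition.transpose i k permutes V"
  by (rule permutes_swap_id)

lemma tr_linear: "i \<in> V \<Longrightarrow> k \<in> V \<Longrightarrow> linear (tr i k)"
  unfolding tr_def by (intro act_linear transpose_permutes)

lemma tr_simps:
  assumes "i \<in> V" "k \<in> V"
  shows "tr i k (x + y) = tr i k x + tr i k y" "tr i k (x - y) = tr i k x - tr i k y"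
    "tr i k (r *\<^sub>R x) = r *\<^sub>R tr i k x" "tr i k 0 = 0"
  using tr_linear[OF assms] by (auto simp: linear_add linear_diff linear_scale linear_0)

lemma tr_tr:
  assumes "i \<in> V" "k \<in> V"
  shows "tr i k (tr i k x) = x"
  using act_comp[OF transpose_permutes transpose_permutes, OF assms assms, of x]
  by (simp add: tr_def act_id)

lemma B_tr: "i \<in> V \<Longrightarrow> k \<in> V \<Longrightarrow> B (tr i k x) y = B x (tr i k y)"
  using B_act[OF transpose_permutes, of i k x "tr i k y"] tr_tr[of i k y]
  by (simp add: tr_def)

text \<open>Relations between products of transpositions are obtained by comparing the underlying permutations on
  the finitely many points that occur, which is a matter of rewriting.\<close>

definition trs :: "('a \<times> 'a) list \<Rightarrow> 'v \<Rightarrow> 'v" where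
  "trs ps x = foldr (\<lambda>(i, k). tr i k) ps x"

definition perm_of :: "('a \<times> 'a) list \<Rightarrow> 'a \<Rightarrow> 'a" where
  "perm_of ps = foldr (\<lambda>(i, k) p. Transposition.transpose i k \<circ> p) ps id"

lemma trs_eq_act:
  assumes "set ps \<subseteq> V \<times> V"
  shows "perm_of ps permutes V \<and> trs ps x = act (perm_of ps) x"
  using assms
proof (induction ps)
  case Nil
  show ?case using permutes_id act_id by (simp add: perm_of_def trs_def id_def)
next
  case (Cons a ps)
  obtain i k where a: "a = (i, k)" by force
  have ik: "Transposition.transpose i k permutes V" using Cons.prems a by (auto intro: transpose_permutes)
  have IH: "perm_of ps permutes V" "trs ps x = act (perm_of ps) x" using Cons by auto
  have "perm_of (a # ps) = Transposition.transpose i k \<circ> perm_of ps"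
    by (simp add: perm_of_def a)
  moreover have "trs (a # ps) x = tr i k (trs ps x)" by (simp add: trs_def a)
  moreover have "\<dots> = act (Transposition.transpose i k \<circ> perm_of ps) x"
    unfolding IH(2) tr_def act_comp[OF ik IH(1)] ..
  ultimately show ?case using permutes_compose[OF IH(1) ik] by metis
qed

definition letters :: "('a \<times> 'a) list \<Rightarrow> 'a set" where
  "letters ps = fst ` set ps \<union> snd ` set ps"

lemma perm_of_fixes: "v \<notin> letters ps \<Longrightarrow> perm_of ps v = v"
  by (induction ps) (auto simp: perm_of_def letters_def Transposition.transpose_def)

lemma trs_cong:
  assumes "letters ps \<subseteq> V" "letters qs \<subseteq> V"
    and "\<forall>v \<in> letters ps \<union> letters qs. perm_of ps v = perm_of qs v"
  shows "trs ps x = trs qs x"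
proof -
  have "set ps \<subseteq> V \<times> V" "set qs \<subseteq> V \<times> V" using assms(1,2) by (auto simp: letters_def image_subset_iff)
  moreover have "perm_of ps = perm_of qs"
    using assms(3) perm_of_fixes by (metis UnI1 UnI2 ext)
  ultimately show ?thesis using trs_eq_act by metis
qed

lemmas word_simps = trs_def perm_of_def letters_def transpose_apply_first transpose_apply_second transpose_apply_other

lemma distinct3:
  assumes "distinct [i, j, k]"
  shows "i \<noteq> j" "j \<noteq> i" "i \<noteq> k" "k \<noteq> i" "j \<noteq> k" "k \<noteq> j"
  using assms by auto

lemma distinct4:
  assumes "distinct [i, j, k, l]"
  shows "i \<noteq> j" "j \<noteq> i" "i \<noteq> k" "k \<noteq> i" "j \<noteq> k" "k \<noteq> j"
    "i \<noteq> l" "l \<noteq> i" "j \<noteq> l" "l \<noteq> j" "k \<noteq> l" "l \<noteq> k"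
  using assms by auto

lemma three_cycle:
  assumes "i \<in> V" "j \<in> V" "k \<in> V" "distinct [i, j, k]"
  shows "tr j k (tr k i x) = tr i j (tr j k x)"
    and "tr i j (tr i k x) = tr i k (tr k j x)"
    and "tr i j (tr j k (tr i j (tr j k x))) = tr i k (tr k j x)"
proof -
  note sm = word_simps assms(1-3) distinct3[OF assms(4)]
  have "trs [(j,k),(k,i)] x = trs [(i,j),(j,k)] x"
    and "trs [(i,j),(i,k)] x = trs [(i,k),(k,j)] x"
    and "trs [(i,j),(j,k),(i,j),(j,k)] x = trs [(i,k),(k,j)] x"
    by (rule trs_cong; simp add: sm)+
  then show "tr j k (tr k i x) = tr i j (tr j k x)"
    and "tr i j (tr i k x) = tr i k (tr k j x)"
    and "tr i j (tr j k (tr i j (tr j k x))) = tr i k (tr k j x)"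
    by (simp_all add: trs_def)
qed

section \<open>The projection onto the component of type (2,2)\<close>

definition klein :: "'a \<Rightarrow> 'a \<Rightarrow> 'a \<Rightarrow> 'a \<Rightarrow> 'v \<Rightarrow> 'v" where
  "klein i j k l x = x + tr i j (tr k l x) + tr i k (tr j l x) + tr i l (tr j k x)"

text \<open>This is the action of the 3-cycle that sends \<open>i\<close> to \<open>j\<close>, \<open>j\<close> to \<open>k\<close> and \<open>k\<close> to \<open>i\<close>.\<close>

definition rot :: "'a \<Rightarrow> 'a \<Rightarrow> 'a \<Rightarrow> 'v \<Rightarrow> 'v" where
  "rot i j k x = tr i j (tr j k x)"

context
  fixes i j k l :: 'a
  assumes inV: "i \<in> V" "j \<in> V" "k \<in> V" "l \<in> V" and dist: "distinct [i, j, k, l]"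
begin

lemma klein_words:
  shows "trs [(i,j),(k,l)] x = trs [(k,l),(i,j)] x"
    and "trs [(i,j),(k,l),(i,k),(j,l)] x = trs [(i,l),(j,k)] x"
    and "trs [(i,j),(k,l),(i,l),(j,k)] x = trs [(i,k),(j,l)] x"
    and "trs [(i,j),(k,l),(i,j),(k,l)] x = trs [] x"
    and "trs [(i,j),(k,l),(j,k),(k,l)] x = trs [(j,k),(k,l),(i,l),(j,k)] x"
    and "trs [(i,k),(j,l),(j,k),(k,l)] x = trs [(j,k),(k,l),(i,j),(k,l)] x"
    and "trs [(i,l),(j,k),(j,k),(k,l)] x = trs [(j,k),(k,l),(i,k),(j,l)] x"
    and "trs [(j,k),(k,l),(i,j),(k,l)] x = trs [(i,k),(k,j)] x"
    and "trs [(j,k),(k,l),(i,k),(j,l)] x = trs [(i,l),(l,k)] x"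
    and "trs [(j,k),(k,l),(i,l),(j,k)] x = trs [(i,j),(j,l)] x"
  by (rule trs_cong; simp add: word_simps inV distinct4[OF dist])+

lemmas klein_rels = klein_words[unfolded trs_def, simplified]

end

lemma klein_swap: "klein i j k l = klein i k j l" "klein i j k l = klein i l j k" "klein i j k l = klein i j l k"
  by (rule ext; simp add: klein_def tr_commute[of k j] tr_commute[of l k] tr_commute[of l j] add_ac)+

text \<open>This is \<open>12 P\<close> for the projection \<open>P\<close> described at the beginning: \<open>klein\<close> is the sum over the Klein four-group,
  and composing it with \<open>1\<close>, \<open>rot j k l\<close> and \<open>rot j l k\<close> gives the three cosets that make up the alternating group.
  The factor avoids fractions.\<close>

definition proj22 :: "'a \<Rightarrow> 'a \<Rightarrow> 'a \<Rightarrow> 'a \<Rightarrow> 'v \<Rightarrow> 'v" where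
  "proj22 i j k l x = 2 *\<^sub>R klein i j k l x - rot j k l (klein i j k l x) - rot j l k (klein i j k l x)"

lemma rot_simps:
  assumes "i \<in> V" "j \<in> V" "k \<in> V"
  shows "rot i j k (x + y) = rot i j k x + rot i j k y" "rot i j k (x - y) = rot i j k x - rot i j k y"
    "rot i j k (r *\<^sub>R x) = r *\<^sub>R rot i j k x" "rot i j k 0 = 0"
  using assms by (simp_all add: rot_def tr_simps)

lemma klein_simps:
  assumes "i \<in> V" "j \<in> V" "k \<in> V" "l \<in> V"
  shows "klein i j k l (x + y) = klein i j k l x + klein i j k l y"
   "klein i j k l (x - y) = klein i j k l x - klein i j k l y"
   "klein i j k l (r *\<^sub>R x) = r *\<^sub>R klein i j k l x"
  using assms by (simp_all add: klein_def tr_simps algebra_simps)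

lemma B_rot: "i \<in> V \<Longrightarrow> j \<in> V \<Longrightarrow> k \<in> V \<Longrightarrow> B (rot i j k x) y = B x (rot k j i y)"
  by (simp add: rot_def B_tr tr_commute)

lemma rot_cyclic:
  assumes "i \<in> V" "j \<in> V" "k \<in> V" "distinct [i, j, k]"
  shows "rot j k i = rot i j k" "rot k i j = rot i j k"
proof -
  show *: "rot j k i = rot i j k" using three_cycle(1)[OF assms] by (auto simp: rot_def)
  show "rot k i j = rot i j k" 
    using three_cycle(1)[of k i j] assms by (auto simp: rot_def *)
qed

lemma rot_rot:
  assumes "i \<in> V" "j \<in> V" "k \<in> V" "distinct [i, j, k]"
  shows "rot i j k (rot i j k x) = rot i k j x" "rot i j k (rot i k j x) = x"
proof -
  show "rot i j k (rot i j k x) = rot i k j x" using three_cycle(3)[OF assms] by (simp add: rot_def)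
  have "rot i k j x = rot k j i x" using rot_cyclic(1)[of i k j] assms by auto
  then show "rot i j k (rot i k j x) = x" 
    using assms(1-3) by (simp add: rot_def tr_tr tr_commute)
qed

text \<open>The block below is closed and reopened several times so that its lemmas become available with the four
  points permuted.\<close>

context
  fixes i j k l :: 'a
  assumes inV: "i \<in> V" "j \<in> V" "k \<in> V" "l \<in> V" and dist: "distinct [i, j, k, l]"
begin

lemma klein_invariant1: "tr i j (tr k l (klein i j k l x)) = klein i j k l x"
  by (simp add: klein_def tr_simps inV klein_rels(2-4)[OF inV dist] add_ac)

lemma klein_adjoint: "B (klein i j k l x) y = B x (klein i j k l y)"
  using klein_rels(1)[of i j k l] klein_rels(1)[of i k j l] klein_rels(1)[of i l j k] inV distinct4[OF dist]
  by (simp add: klein_def B_simps B_tr)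

text \<open>The Klein four-group is normal in the symmetric group on the four points.\<close>

lemma klein_rot: "klein i j k l (rot j k l x) = rot j k l (klein i j k l x)"
  by (simp add: klein_def rot_def tr_simps inV klein_rels(5-7)[OF inV dist] add_ac)

lemma rot_klein:
  "rot j k l (klein i j k l x) = rot j k l x + rot i k j x + rot i l k x + rot i j l x"
  unfolding klein_def rot_def
  by (simp add: tr_simps inV klein_rels(8-10)[OF inV dist])

end

context
  fixes i j k l :: 'a
  assumes inV: "i \<in> V" "j \<in> V" "k \<in> V" "l \<in> V" and dist: "distinct [i, j, k, l]"
begin

lemma klein_invariant:
  shows "tr i j (tr k l (klein i j k l x)) = klein i j k l x"
    "tr i k (tr j l (klein i j k l x)) = klein i j k l x"
    "tr i l (tr j k (klein i j k l x)) = klein i j k l x"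
  using klein_invariant1[of i j k l x] klein_invariant1[of i k j l x] klein_invariant1[of i l j k x] 
    inV dist klein_swap[of i j k l]
  by auto

lemma klein_klein: "klein i j k l (klein i j k l x) = 4 *\<^sub>R klein i j k l x"
proof -
  define z where "z = klein i j k l x"
  have "klein i j k l z = z + z + z + z"
    unfolding klein_def[of i j k l z] by (simp add: klein_invariant z_def)
  also have "\<dots> = 4 *\<^sub>R z" using scaleR_left_distrib[of 2 2 z] by (simp add: scaleR_2 add_ac)
  finally show ?thesis by (simp add: z_def)
qed

lemma klein_rot': "klein i j k l (rot j l k x) = rot j l k (klein i j k l x)"
  using klein_rot[of i j l k x] inV dist klein_swap(3)[of i j k l] by auto

lemma proj22_klein: "klein i j k l (proj22 i j k l x) = 4 *\<^sub>R proj22 i j k l x"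
  by (simp add: proj22_def klein_simps inV klein_rot[OF inV dist] klein_rot' klein_klein
    rot_simps scaleR_right_diff_distrib)

lemma proj22_adjoint: "B (proj22 i j k l x) y = B x (proj22 i j k l y)"
proof -
  have r: "rot k j l = rot j l k" "rot l k j = rot j l k" "rot k l j = rot j k l"
    using rot_cyclic[of j l k] rot_cyclic[of j k l] inV dist by auto
  show ?thesis
   by (simp add: proj22_def B_simps B_rot inV klein_adjoint[OF inV dist] r klein_rot[OF inV dist] klein_rot')
qed

text \<open>The image of the projection contains no nonzero vector fixed by a 3-cycle, since \<open>1\<close>, \<open>rot\<close> and \<open>rot\<^sup>2\<close> add up to zero
  on the two-dimensional representation. Together with invariance under the Klein four-group, this is all that is used
  about vectors in the image.\<close>

lemma proj22_rot_sum:
  "proj22 i j k l x + rot j k l (proj22 i j k l x) + rot j l k (proj22 i j k l x) = 0"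
proof -
  have d: "distinct [j,k,l]" "distinct [j,l,k]" using dist by auto
  show ?thesis
  by (simp add: proj22_def rot_simps inV rot_rot[OF inV(2-4) d(1)] rot_rot[OF inV(2,4,3) d(2)] scaleR_2)
qed

lemma proj22_proj22: "proj22 i j k l (proj22 i j k l x) = 12 *\<^sub>R proj22 i j k l x"
proof -
  define y where "y = proj22 i j k l x"
  have K: "klein i j k l y = 4 *\<^sub>R y" by (simp add: y_def proj22_klein)
  have "rot j k l y + rot j l k y = - y"
    using proj22_rot_sum[of x] by (simp add: y_def eq_neg_iff_add_eq_0 add_ac)
  moreover have "proj22 i j k l y = 8 *\<^sub>R y - 4 *\<^sub>R (rot j k l y + rot j l k y)"
    by (simp add: proj22_def[of i j k l y] K rot_simps inV scaleR_right_distrib)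
  ultimately have "proj22 i j k l y = 12 *\<^sub>R y" by (simp add: scaleR_left_distrib[symmetric])
  then show ?thesis by (simp add: y_def)
qed

lemma proj22_square: "B (proj22 i j k l x) (proj22 i j k l x) = 12 * B (proj22 i j k l x) x"
  using proj22_adjoint[of x "proj22 i j k l x"] by (simp add: proj22_proj22 B_simps B_sym)

lemma proj22_nonneg: "B (proj22 i j k l x) x \<ge> 0"
  using proj22_square[of x] B_nonneg[of "proj22 i j k l x"] by simp

text \<open>Modulo the Klein four-group the eight 3-cycles fall into two classes, mutually inverse.\<close>

lemma invariant_rot:
  assumes "tr i j (tr k l y) = y" "tr i k (tr j l y) = y" "tr i l (tr j k y) = y"
  shows "rot i k j y = rot j k l y" "rot i l k y = rot j k l y" "rot i j l y = rot j k l y"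
  using klein_rels(8-10)[OF inV dist, of y] assms by (simp_all add: rot_def)

end

context
  fixes i j k l :: 'a
  assumes inV: "i \<in> V" "j \<in> V" "k \<in> V" "l \<in> V" and dist: "distinct [i, j, k, l]"
begin

lemma proj22_rot_sums:
  fixes x
  defines "y \<equiv> proj22 i j k l x"
  shows "y + rot j k l y + rot j l k y = 0" "y + rot i k l y + rot i l k y = 0"
    "y + rot i j l y + rot i l j y = 0" "y + rot i j k y + rot i k j y = 0"
proof -
  have K: "klein i j k l y = 4 *\<^sub>R y" by (simp add: y_def proj22_klein[OF inV dist])
  have inv: "tr i j (tr k l y) = y" "tr i k (tr j l y) = y" "tr i l (tr j k y) = y"
    using klein_invariant[OF inV dist, of y] by (simp_all add: tr_simps inV K)
  note r = invariant_rot[OF inV dist inv]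
  have r': "rot i l j y = rot j l k y" "rot i k l y = rot j l k y" "rot i j k y = rot j l k y"
    using invariant_rot[of i j l k y] inv inV distinct4[OF dist] by (simp_all add: tr_commute[of l k])
  show 0: "y + rot j k l y + rot j l k y = 0" using proj22_rot_sum[OF inV dist, of x] by (simp add: y_def)
  show "y + rot i k l y + rot i l k y = 0" "y + rot i j l y + rot i l j y = 0" 
    "y + rot i j k y + rot i k j y = 0"
    using 0 by (simp_all add: r r' add_ac)
qed

end

section \<open>The five-point inequality\<close>

text \<open>A vector on which the average over one 3-cycle vanishes has vanishing average over the alternating group
  as well, so on it the projection is the average over the Klein four-group alone.\<close>

lemma proj22_of_rot_sum_zero:
  assumes inV: "i \<in> V" "j \<in> V" "k \<in> V" "l \<in> V" and dist: "distinct [i, j, k, l]"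
    and y: "y + rot j k l y + rot j l k y = 0"
  shows "proj22 i j k l y = 3 *\<^sub>R klein i j k l y"
proof -
  have "rot j k l y + rot j l k y = - y" using y by (simp add: eq_neg_iff_add_eq_0 add_ac)
  then have "klein i j k l (rot j k l y) + klein i j k l (rot j l k y) = - klein i j k l y"
    using klein_simps(1,3)[OF inV] by (metis scaleR_minus1_left)
  then show ?thesis 
    using scaleR_left_distrib[of 2 1 "klein i j k l y"]
    by (simp add: proj22_def klein_rot[OF inV dist, symmetric] klein_rot'[OF inV dist, symmetric] algebra_simps)
qed

text \<open>By the preceding lemma the four projections applied to \<open>y\<close> are, up to a common factor, sums over Klein
  four-groups. Each sum contains \<open>y\<close> itself, and together they contain one summand for every double transposition that
  moves the new point \<open>p\<close>. The three of those that send \<open>p\<close> to a given point \<open>a\<close> differ by the powers of a 3-cycle on the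
  other three points, so that they cancel on \<open>y\<close>.\<close>

lemma five_point_reproducing:
  fixes i j k l p x
  assumes inV: "i \<in> V" "j \<in> V" "k \<in> V" "l \<in> V" "p \<in> V" and dist: "distinct [p, i, j, k, l]"
  defines "y \<equiv> proj22 i j k l x"
  shows "proj22 p i j k y + proj22 p i j l y + proj22 p i k l y + proj22 p j k l y = 12 *\<^sub>R y"
proof -
  have d: "distinct [i, j, k, l]" using dist by auto
  note z = proj22_rot_sums[OF inV(1-4) d, of x, folded y_def]
  have e: "tr p a (tr b c y) + tr p a (tr b e y) + tr p a (tr c e y) = 0"
    if "a \<in> V" "b \<in> V" "c \<in> V" "e \<in> V" and dd: "distinct [b,c,e]" "y + rot b c e y + rot b e c y = 0"
    for a b c e
  proof -
    have "tr b c (tr b c y + tr b e y + tr c e y) = y + rot b c e y + rot b e c y"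
      using three_cycle(2)[of b c e y] that by (simp add: tr_simps tr_tr rot_def add_ac)
    then have "tr b c (tr b c (tr b c y + tr b e y + tr c e y)) = 0" using dd that by (simp add: tr_simps)
    then have "tr b c y + tr b e y + tr c e y = 0" using that by (simp add: tr_tr)
    then have "tr p a (tr b c y + tr b e y + tr c e y) = 0" using that inV by (simp add: tr_simps)
    then show ?thesis using that inV by (simp add: tr_simps)
  qed
  have "klein p i j k y + klein p i j l y + klein p i k l y + klein p j k l y
    = 4 *\<^sub>R y + (tr p i (tr j k y) + tr p i (tr j l y) + tr p i (tr k l y))
     + (tr p j (tr i k y) + tr p j (tr i l y) + tr p j (tr k l y))
     + (tr p k (tr i j y) + tr p k (tr i l y) + tr p k (tr j l y))
     + (tr p l (tr i j y) + tr p l (tr i k y) + tr p l (tr j k y))"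
    using scaleR_left_distrib[of 2 2 y] by (simp add: klein_def scaleR_2 add_ac)
  also have "\<dots> = 4 *\<^sub>R y"
    using dist inV by (simp add: e z)
  finally show ?thesis
    using proj22_of_rot_sum_zero[of p i j k y] proj22_of_rot_sum_zero[of p i j l y]
     proj22_of_rot_sum_zero[of p i k l y] proj22_of_rot_sum_zero[of p j k l y] dist inV z
    by (simp flip: scaleR_right_distrib)
qed

text \<open>If positive operators \<open>P\<^sub>l\<close> satisfy \<open>\<Sum>\<^sub>l P\<^sub>l y = y\<close> for \<open>y = P x\<close>, where \<open>P\<close> is an orthogonal projection, then expanding
  \<open>\<Sum>\<^sub>l \<langle>P\<^sub>l (x - y), x - y\<rangle> \<ge> 0\<close> gives \<open>\<Sum>\<^sub>l \<langle>P\<^sub>l x, x\<rangle> \<ge> \<langle>P x, x\<rangle>\<close>.\<close>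

lemma five_point_inequality:
  assumes inV: "i \<in> V" "j \<in> V" "k \<in> V" "l \<in> V" "p \<in> V" and dist: "distinct [p, i, j, k, l]"
  shows "B (proj22 i j k l x) x \<le> B (proj22 p i j k x) x + B (proj22 p i j l x) x
    + B (proj22 p i k l x) x + B (proj22 p j k l x) x"
proof -
  define y where "y = proj22 i j k l x"
  define v where "v = x - (1/12) *\<^sub>R y"
  have exp: "B (proj22 p a b c v) v = B (proj22 p a b c x) x - B (proj22 p a b c y) x / 6 
     + B (proj22 p a b c y) y / 144"
    if "a \<in> V" "b \<in> V" "c \<in> V" "distinct [p,a,b,c]" for a b c
  proof -
    have "proj22 p a b c v = proj22 p a b c x - (1/12) *\<^sub>R proj22 p a b c y"
      using that inV by (simp add: v_def proj22_def klein_simps rot_simps algebra_simps)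
    moreover have "B (proj22 p a b c x) y = B (proj22 p a b c y) x"
      using proj22_adjoint[of p a b c x y] B_sym that inV by auto
    ultimately show ?thesis
      unfolding v_def by (simp add: B_simps) (simp add: field_simps)
  qed
  have s: "B (proj22 p i j k y) z + B (proj22 p i j l y) z + B (proj22 p i k l y) z + B (proj22 p j k l y) z = 12 * B y z" for z
    using arg_cong[OF five_point_reproducing[OF inV dist, of x], of "\<lambda>u. B u z"] 
    by (simp add: B_simps y_def)
  have yy: "B y y = 12 * B y x" using proj22_square[OF inV(1-4)] dist by (simp add: y_def)
  have "0 \<le> B (proj22 p i j k v) v + B (proj22 p i j l v) v + B (proj22 p i k l v) v + B (proj22 p j k l v) v"
    using dist inV by (intro add_nonneg_nonneg proj22_nonneg) auto
  also have "\<dots> = B (proj22 p i j k x) x + B (proj22 p i j l x) x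
    + B (proj22 p i k l x) x + B (proj22 p j k l x) x - B y x"
    using s[of x] s[of y] yy exp[of i j k] exp[of i j l] exp[of i k l] exp[of j k l] dist inV by simp
  finally show ?thesis by (simp add: y_def)
qed

section \<open>The quartic identity\<close>

definition gram :: "'v \<Rightarrow> 'a \<Rightarrow> 'a \<Rightarrow> 'a \<Rightarrow> 'a \<Rightarrow> real" where
  "gram x i j k l = B (tr i j x) (tr k l x)"

lemma gram_sym: "gram x i j k l = gram x j i k l" "gram x i j k l = gram x i j l k"
   "gram x i j k l = gram x k l i j"
  by (simp_all add: gram_def tr_commute[of j i] tr_commute[of k l] B_sym)

lemma gram_three_cycle:
  assumes inV: "i \<in> V" "j \<in> V" "k \<in> V" and dist: "distinct [i, j, k]"
  shows "gram x j k k i = gram x i j j k"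
  using three_cycle(1)[OF assms, of x] B_tr[of i j x "tr j k x"] B_tr[of j k x "tr k i x"] assms 
  by (simp add: gram_def)

lemma B_rot_self: "i \<in> V \<Longrightarrow> j \<in> V \<Longrightarrow> k \<in> V \<Longrightarrow> B (rot i j k x) x = gram x i j j k"
  by (simp add: gram_def rot_def B_tr B_sym)

text \<open>A 3-cycle and its inverse have the same real matrix coefficient, so the coefficient depends only on the
  underlying set of three points.\<close>

lemma gram_triple:
  assumes inV: "i \<in> V" "j \<in> V" "k \<in> V" and dist: "distinct [i, j, k]"
  shows "gram x i k k j = gram x i j j k" "gram x j i i k = gram x i j j k"
proof -
  show 1: "gram x i k k j = gram x i j j k"
    by (subst gram_sym(3), subst gram_sym(1), subst gram_sym(2)) (rule gram_three_cycle[OF assms])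
  show "gram x j i i k = gram x i j j k"
    using gram_three_cycle[of k i j x] assms
    by (subst gram_sym(3), subst gram_sym(1), subst gram_sym(2)) auto
qed

text \<open>The eight 3-cycles are paired with their inverses, which leaves one term for each three-element
  subset.\<close>

lemma proj22_gram:
  assumes inV: "i \<in> V" "j \<in> V" "k \<in> V" "l \<in> V" and dist: "distinct [i, j, k, l]"
  shows "B (proj22 i j k l x) x = 2 * (B x x + gram x i j k l + gram x i k j l + gram x i l j k
    - (gram x i j j k + gram x i j j l + gram x i k k l + gram x j k k l))"
proof -
  have tt: "B (tr a b (tr c d x)) x = gram x a b c d" if "a \<in> V" "b \<in> V" for a b c d
    using B_tr[OF that, of "tr c d x" x] B_sym[of "tr c d x"] by (simp add: gram_def)
  have K: "B (klein i j k l x) x = B x x + gram x i j k l + gram x i k j l + gram x i l j k"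
    by (simp add: klein_def B_simps tt inV)
  have R1: "B (rot j k l (klein i j k l x)) x 
      = gram x j k k l + gram x i k k j + gram x i l l k + gram x i j j l"
    by (simp add: rot_klein[OF inV dist] B_simps B_rot_self inV)
  have R2: "B (rot j l k (klein i j k l x)) x 
      = gram x j l l k + gram x i l l j + gram x i k k l + gram x i j j k"
    using rot_klein[of i j l k] inV distinct4[OF dist] 
    by (simp add: klein_swap(3)[of i j k l] B_simps B_rot_self)
  have "gram x i k k j = gram x i j j k" "gram x i l l k = gram x i k k l" 
    "gram x j l l k = gram x j k k l" "gram x i l l j = gram x i j j l"
    using gram_triple(1)[of i j k] gram_triple(1)[of i k l] gram_triple(1)[of j k l] gram_triple(1)[of i j l]
     inV dist by auto
  then show ?thesis by (simp add: proj22_def B_simps K R1 R2)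
qed

text \<open>Summed with weights \<open>a\<^sub>i a\<^sub>j a\<^sub>k a\<^sub>l\<close>, this gives the quadratic form of \<open>2DS - S\<^sup>2\<close>; the term \<open>DS\<close> is written in two ways
  to respect the symmetry between \<open>(i, j)\<close> and \<open>(k, l)\<close>.\<close>

definition quartic :: "'v \<Rightarrow> 'a \<Rightarrow> 'a \<Rightarrow> 'a \<Rightarrow> 'a \<Rightarrow> real" where
  "quartic x i j k l = (if i = j then B (tr k l x) x else 0) + (if k = l then B (tr i j x) x else 0)
     - gram x i j k l"

text \<open>On distinct indices the values are dictated by \<open>proj22_gram\<close>: each three-element subset accounts for one
  3-cycle coefficient and for a quarter of the identity. The values on coinciding indices make \<open>quartic_identity\<close>
  hold for degenerate quadruples as well.\<close>

definition cubic :: "'v \<Rightarrow> 'a \<Rightarrow> 'a \<Rightarrow> 'a \<Rightarrow> real" where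
  "cubic x i j k = (if i = j \<and> j = k then 3 / 4 * B x x
     else if distinct [i, j, k] then B x x / 4 - gram x i j j k else - (B x x / 4))"

definition deviation :: "'v \<Rightarrow> 'a \<Rightarrow> 'a \<Rightarrow> 'a \<Rightarrow> 'a \<Rightarrow> real" where
  "deviation x i j k l = (if distinct [i, j, k, l] then B (proj22 i j k l x) x else 0)"

lemma B_tr_triple:
  assumes "i \<in> V" "j \<in> V" "k \<in> V" "distinct [i, j, k]"
  shows "B (tr i j x) (tr i k x) = B (tr i j x) (tr j k x)" 
    "B (tr i k x) (tr j k x) = B (tr i j x) (tr j k x)" 
  using gram_triple[OF assms, of x] B_sym
  by (auto simp: gram_def tr_commute[of j i] tr_commute[of k j])

text \<open>The three terms on the left correspond to the three ways of splitting the quadruple into two pairs;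
  they have equal weighted sums.\<close>

lemma quartic_identity:
  assumes inV: "i \<in> V" "j \<in> V" "k \<in> V" "l \<in> V"
  shows "quartic x i j k l + quartic x i k j l + quartic x i l j k
    = cubic x i j k + cubic x i j l + cubic x i k l + cubic x j k l - deviation x i j k l / 2"
proof (cases "distinct [i, j, k, l]")
  case True
  then show ?thesis
    using proj22_gram[OF inV True, of x] distinct4[OF True]
    by (simp add: quartic_def cubic_def deviation_def field_simps)
next
  case False
  note unf = quartic_def cubic_def deviation_def
  have sx: "B x (tr a b x) = B (tr a b x) x" for a b by (rule B_sym)
  \<comment> \<open>Exactly two of the four indices coincide; the position of the equal pair is immaterial.\<close>
  have one_pair: ?thesis if abc: "a \<in> V" "b \<in> V" "c \<in> V" "distinct [a, b, c]"
    and p: "(i,j,k,l) \<in> {(a,a,b,c), (a,b,a,c), (a,b,c,a), (b,a,a,c), (b,a,c,a), (b,c,a,a)}" for a b c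
  proof -
    note n = gram_def tr_same tr_commute[of b a] tr_commute[of c a] tr_commute[of c b]
      B_sym[of "tr a c x" "tr a b x"] B_sym[of "tr b c x" "tr a b x"] B_sym[of "tr b c x" "tr a c x"]
      sx B_tr_triple[OF abc]
    show ?thesis
      using p distinct3[OF abc(4)] by (auto simp: unf n)
  qed
  have deg: "B (tr a b x) (tr a b x) = B x x" if "a \<in> V" "b \<in> V" for a b
     using that by (simp add: B_tr tr_tr)
  consider "distinct [i,j,k] \<and> l \<in> {i,j,k}" | "distinct [i,j,l] \<and> k \<in> {i,j}" 
   | "distinct [i,k,l] \<and> j = i" | "i = j \<and> k = l" | "i = k \<and> j = l"  | "i = l \<and> j = k"
   | "i = j \<and> j = k" | "i = j \<and> j = l" | "i = k \<and> k = l" | "j = k \<and> k = l"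
    using False by (auto)
  then show ?thesis
  proof cases
    case 1
    then show ?thesis using one_pair[of i j k] one_pair[of j i k] one_pair[of k i j] inV by auto
  next
    case 2
    then show ?thesis using one_pair[of i j l] one_pair[of j i l] inV by auto
  next
    case 3
    then show ?thesis using one_pair[of i k l] inV by auto
  next
    case 4
    then show ?thesis using inV by (cases "i = k"; simp add: unf gram_def tr_same deg sx)
  next
    case 5
    then show ?thesis using inV
      by (cases "i = j"; simp add: unf gram_def tr_same deg sx tr_commute[of l k])
  next
    case 6
    then show ?thesis using inV
      by (cases "i = j"; simp add: unf gram_def tr_same deg sx tr_commute[of l k])
  next
    case 7
    then show ?thesis using inV by (cases "i = l"; simp add: unf gram_def tr_same deg sx)
  next
    case 8
    then show ?thesis using inV by (cases "i = k"; simp add: unf gram_def tr_same deg sx)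
  next
    case 9
    then show ?thesis using inV by (cases "i = j"; simp add: unf gram_def tr_same deg sx)
  next
    case 10
    then show ?thesis using inV by (cases "i = j"; simp add: unf gram_def tr_same deg sx)
  qed
qed

section \<open>The octopus inequality\<close>

lemma deviation_swap:
  assumes inV: "i \<in> V" "j \<in> V" "k \<in> V" "l \<in> V"
  shows "deviation x i j k l = deviation x j i k l" "deviation x i j k l = deviation x i k j l"
    "deviation x i j k l = deviation x i j l k"
proof -
  have "deviation x i j k l = deviation x j i k l \<and> deviation x i j k l = deviation x i k j l
    \<and> deviation x i j k l = deviation x i j l k"
  proof (cases "distinct [i, j, k, l]")
    case True
    have d: "distinct [j,i,k,l]" "distinct [i,k,j,l]" "distinct [i,j,l,k]" using True by auto
    have t: "gram x j i i k = gram x i j j k" "gram x j i i l = gram x i j j l" 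
      "gram x i k k j = gram x i j j k" "gram x k j j l = gram x j k k l"
      "gram x i l l k = gram x i k k l" "gram x j l l k = gram x j k k l"
      using gram_triple[of i j k x] gram_triple[of i j l x] gram_triple[of j k l x] gram_triple[of i k l x] inV True by auto
    have g: "gram x j i k l = gram x i j k l" "gram x j k i l = gram x i l j k" "gram x j l i k = gram x i k j l" 
      "gram x i l k j = gram x i l j k" "gram x i j l k = gram x i j k l"
      by (simp_all add: gram_def tr_commute[of j i] tr_commute[of k j] tr_commute[of l k]
        B_sym[of "tr j k x"] B_sym[of "tr j l x"])
    show ?thesis
      using proj22_gram[OF inV(2,1,3,4) d(1), of x] proj22_gram[OF inV(1,3,2,4) d(2), of x] 
       proj22_gram[OF inV(1,2,4,3) d(3), of x] proj22_gram[OF inV True, of x] d True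
      by (simp add: deviation_def t g)
  qed (auto simp: deviation_def)
  then show "deviation x i j k l = deviation x j i k l" "deviation x i j k l = deviation x i k j l"
    "deviation x i j k l = deviation x i j l k" by auto
qed

lemma deviation_nonneg:
  "i \<in> V \<Longrightarrow> j \<in> V \<Longrightarrow> k \<in> V \<Longrightarrow> l \<in> V \<Longrightarrow> deviation x i j k l \<ge> 0"
  by (simp add: deviation_def proj22_nonneg)

text \<open>Quadruples through \<open>p\<close> carry the negative factor \<open>a p = - sum a L\<close>. Expanding this factor turns them into a
  sum over quadruples in \<open>L\<close> of the right-hand side of the five-point inequality.\<close>

lemma weighted_deviation_nonpos:
  assumes fin: "finite L" and p: "p \<notin> L" and V: "V = insert p L"
    and a: "\<And>i. i \<in> L \<Longrightarrow> a i \<ge> 0" and sum0: "sum a V = 0"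
  shows "weighted_sum4 V a (deviation x) \<le> 0"
proof -
  let ?T = "\<Sum>i\<in>L. \<Sum>j\<in>L. \<Sum>k\<in>L. a i * a j * a k * deviation x p i j k"
  have LV: "p \<in> V" "\<And>i. i \<in> L \<Longrightarrow> i \<in> V" using V by auto
  have ap: "a p = - sum a L" using sum0 fin p by (simp add: V)
  have "weighted_sum4 V a (deviation x) = weighted_sum4 L a (deviation x) + 4 * a p * ?T"
    unfolding V
  proof (rule weighted_sum4_insert[OF fin p])
    fix i j k assume "i \<in> L" "j \<in> L" "k \<in> L"
    then show "deviation x i p j k = deviation x p i j k \<and> deviation x i j p k = deviation x p i j k \<and>
       deviation x i j k p = deviation x p i j k"
      using deviation_swap LV by metis
  qed (simp_all add: deviation_def)
  moreover have "weighted_sum4 L a (deviation x) \<le> weighted_sum4 L a (\<lambda>i j k l. 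
      deviation x p i j k + deviation x p i j l + deviation x p i k l + deviation x p j k l)"
  proof (rule weighted_sum4_mono[OF a])
    fix i j k l assume L: "i \<in> L" "j \<in> L" "k \<in> L" "l \<in> L"
    show "deviation x i j k l \<le> deviation x p i j k + deviation x p i j l + deviation x p i k l
        + deviation x p j k l"
    proof (cases "distinct [i, j, k, l]")
      case True
      then have "distinct [p, i, j, k, l]" using p L by auto
      then show ?thesis
        using five_point_inequality[of i j k l p x] L LV by (simp add: deviation_def)
    next
      case False
      then have "deviation x i j k l = 0" by (auto simp: deviation_def)
      then show ?thesis using L LV by (simp add: deviation_nonneg)
    qed
  qed
  ultimately show ?thesis by (simp add: ap weighted_sum4_triples)
qed

lemma B_sum: "B (\<Sum>i\<in>A. f i) y = (\<Sum>i\<in>A. B (f i) y)" "B y (\<Sum>i\<in>A. f i) = (\<Sum>i\<in>A. B y (f i))"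
  using B_bilinear linear_sum[of "\<lambda>u. B u y"] linear_sum[of "B y"] by (auto simp: bilinear_def)

text \<open>The operator \<open>S\<close> of the introduction is positive: the previous lemmas give \<open>2 D \<langle>S x, x\<rangle> \<ge> \<langle>S x, S x\<rangle> \<ge> 0\<close>.\<close>

lemma weighted_transpositions_nonneg:
  assumes fin: "finite L" and p: "p \<notin> L" and V: "V = insert p L"
    and a: "\<And>i. i \<in> L \<Longrightarrow> a i \<ge> 0" and sum0: "sum a V = 0"
  shows "(\<Sum>i\<in>V. \<Sum>k\<in>V. a i * a k * B (tr i k x) x) \<ge> 0"
proof -
  define S where "S = (\<Sum>i\<in>V. \<Sum>k\<in>V. (a i * a k) *\<^sub>R tr i k x)"
  define \<beta> where "\<beta> = (\<Sum>i\<in>V. \<Sum>k\<in>V. a i * a k * B (tr i k x) x)"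
  define D where "D = (\<Sum>i\<in>V. a i * a i)"
  have finV: "finite V" using fin V by simp
  have gram_eq: "gram x i j k l = B (tr k l x) (tr i j x)" for i j k l
    unfolding gram_def by (rule B_sym)
  have SS: "weighted_sum4 V a (gram x) = B S S"
    by (simp add: gram_eq S_def B_sum B_simps weighted_sum4_def sum_distrib_left mult_ac)
  have d1: "weighted_sum4 V a (\<lambda>i j k l. if i = j then B (tr k l x) x else 0) = D * \<beta>"
  proof -
    have "(\<Sum>k\<in>V. \<Sum>l\<in>V. a i * a j * a k * a l * (if i = j then B (tr k l x) x else 0))
      = (if i = j then a i * a i * \<beta> else 0)" for i j
      by (simp add: \<beta>_def sum_distrib_left mult_ac)
    then show ?thesis
      by (simp add: weighted_sum4_def D_def sum_distrib_right finV)
  qed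
  have d2: "weighted_sum4 V a (\<lambda>i j k l. if k = l then B (tr i j x) x else 0) = D * \<beta>"
  proof -
    have "(\<Sum>k\<in>V. \<Sum>l\<in>V. a i * a j * a k * a l * (if k = l then B (tr i j x) x else 0))
      = D * (a i * a j * B (tr i j x) x)" for i j
      by (simp add: D_def sum_distrib_right sum_distrib_left finV mult_ac if_distrib cong: if_cong)
    then show ?thesis by (simp add: weighted_sum4_def \<beta>_def sum_distrib_left)
  qed
  have q1: "weighted_sum4 V a (quartic x) = 2 * D * \<beta> - B S S"
    unfolding quartic_def[abs_def] by (simp add: weighted_sum4_linear d1 d2 SS)
  have q2: "weighted_sum4 V a (\<lambda>i j k l. quartic x i k j l) = weighted_sum4 V a (quartic x)"
    by (rule weighted_sum4_swap(2))
  have q3: "weighted_sum4 V a (\<lambda>i j k l. quartic x i l j k) = weighted_sum4 V a (quartic x)"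
    using weighted_sum4_swap(3)[of V a "\<lambda>i j k l. quartic x i k j l"] q2 by simp
  have "3 * (2 * D * \<beta> - B S S) = weighted_sum4 V a
      (\<lambda>i j k l. quartic x i j k l + quartic x i k j l + quartic x i l j k)"
    by (simp add: weighted_sum4_linear q2 q3 q1)
  also have "\<dots> = weighted_sum4 V a (\<lambda>i j k l. (cubic x i j k + cubic x i j l + cubic x i k l
      + cubic x j k l) - deviation x i j k l / 2)"
    unfolding weighted_sum4_def by (intro sum.cong refl arg_cong2[of _ _ _ _ "(*)"] quartic_identity)
  also have "\<dots> = - weighted_sum4 V a (deviation x) / 2"
    unfolding weighted_sum4_linear(2,3) weighted_sum4_triples by (simp add: sum0)
  also have "\<dots> \<ge> 0"
    using weighted_deviation_nonpos[OF assms] by simp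
  finally have D\<beta>: "D * \<beta> \<ge> 0" using B_nonneg[of S] by simp
  show ?thesis
  proof (cases "D = 0")
    case True
    then have "\<forall>i\<in>V. a i = 0" using finV by (simp add: D_def sum_nonneg_eq_0_iff)
    then show ?thesis by simp
  next
    case False
    moreover have "D \<ge> 0" by (simp add: D_def sum_nonneg)
    ultimately show ?thesis using D\<beta> by (simp add: zero_le_mult_iff \<beta>_def)
  qed
qed

text \<open>The case of \<open>weighted_transpositions_nonneg\<close> with weight \<open>- sum a L\<close> at \<open>p\<close>, rewritten so that only differences
  from the identity occur.\<close>

theorem octopus_inequality:
  assumes fin: "finite L" and p: "p \<notin> L" and V: "V = insert p L"
    and a: "\<And>i. i \<in> L \<Longrightarrow> a i \<ge> 0"
  shows "(\<Sum>i\<in>L. \<Sum>k\<in>L. a i * a k * (B x x - B (tr i k x) x))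
    \<le> 2 * sum a L * (\<Sum>i\<in>L. a i * (B x x - B (tr i p x) x))"
proof -
  define s where "s = sum a L"
  define c where "c = a(p := - s)"
  have cL: "c i = a i" if "i \<in> L" for i using that p by (auto simp: c_def)
  have "sum c L = s" unfolding s_def by (rule sum.cong) (auto simp: cL)
  then have "sum c V = 0" using fin p by (simp add: V c_def)
  then have "0 \<le> (\<Sum>i\<in>V. \<Sum>k\<in>V. c i * c k * B (tr i k x) x)"
    using weighted_transpositions_nonneg[OF fin p V, of c x] a cL by simp
  also have "\<dots> = s * s * B x x - 2 * s * (\<Sum>i\<in>L. a i * B (tr i p x) x)
     + (\<Sum>i\<in>L. \<Sum>k\<in>L. a i * a k * B (tr i k x) x)"
  proof -
    have cp: "c p = - s" by (simp add: c_def)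
    have e: "c p * c k * B (tr p k x) x = - s * (a k * B (tr k p x) x)"
      "c k * c p * B (tr k p x) x = - s * (a k * B (tr k p x) x)" if "k \<in> L" for k
      using cL[OF that] tr_commute[of p k] by (simp_all add: cp)
    have "(\<Sum>i\<in>L. \<Sum>k\<in>L. c i * c k * B (tr i k x) x) = (\<Sum>i\<in>L. \<Sum>k\<in>L. a i * a k * B (tr i k x) x)"
      by (intro sum.cong refl) (simp add: cL)
    moreover have "c p * c p * B (tr p p x) x = s * s * B x x" by (simp add: cp tr_same)
    ultimately show ?thesis using fin p
      by (simp add: V sum.distrib e sum_negf flip: sum_distrib_left)
  qed
  finally have "2 * s * (\<Sum>i\<in>L. a i * B (tr i p x) x) 
     \<le> s * s * B x x + (\<Sum>i\<in>L. \<Sum>k\<in>L. a i * a k * B (tr i k x) x)" by simp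
  moreover have "(\<Sum>i\<in>L. \<Sum>k\<in>L. a i * a k * B x x) = s * s * B x x"
    unfolding s_def sum_product by (simp only: sum_distrib_right)
  moreover have "(\<Sum>i\<in>L. a i * B x x) = s * B x x" by (simp add: s_def sum_distrib_right)
  ultimately show ?thesis
    unfolding s_def[symmetric] by (simp add: right_diff_distrib sum_subtractf)
qed

end

section \<open>Unitary representations as isometric actions\<close>

text \<open>The dimension \<open>d\<close> is a variable, so the space \<open>\<complex>\<^sup>d\<close> is not a type. It is embedded into the real vector
  space of all finitely supported complex sequences, as those supported on \<open>{..<d}\<close>.\<close>

definition vec_of_coeffs :: "nat \<Rightarrow> (nat \<Rightarrow>\<^sub>0 complex) \<Rightarrow> complex vec" where
  "vec_of_coeffs d f = vec d (Poly_Mapping.lookup f)"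

definition coeffs_of_vec :: "complex vec \<Rightarrow> (nat \<Rightarrow>\<^sub>0 complex)" where
  "coeffs_of_vec v = (\<Sum>i<dim_vec v. Poly_Mapping.single i (v $ i))"

lemma lookup_coeffs_of_vec:
  "Poly_Mapping.lookup (coeffs_of_vec v) i = (if i < dim_vec v then v $ i else 0)"
  by (simp add: coeffs_of_vec_def lookup_sum lookup_single when_def)

lemma lookup_scaleR: "Poly_Mapping.lookup (r *\<^sub>R f) i = r *\<^sub>R Poly_Mapping.lookup f i"
proof -
  have "finite {i. r *\<^sub>R Poly_Mapping.lookup f i \<noteq> 0}"
    by (rule finite_subset[OF _ finite_lookup[of f]]) auto
  then show ?thesis by (simp add: scaleR_poly_mapping_def Abs_poly_mapping_inverse)
qed

lemma vec_of_coeffs_carrier [simp]: "vec_of_coeffs d f \<in> carrier_vec d"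
  by (simp add: vec_of_coeffs_def)

lemma vec_of_coeffs_linear:
  "vec_of_coeffs d (f + g) = vec_of_coeffs d f + vec_of_coeffs d g"
  "vec_of_coeffs d (r *\<^sub>R f) = complex_of_real r \<cdot>\<^sub>v vec_of_coeffs d f"
  by (auto simp: vec_of_coeffs_def lookup_add lookup_scaleR scaleR_conv_of_real)

lemma vec_of_coeffs_of_vec:
  "v \<in> carrier_vec d \<Longrightarrow> vec_of_coeffs d (coeffs_of_vec v) = v"
  by (auto simp: vec_of_coeffs_def lookup_coeffs_of_vec)

lemma coeffs_of_vec_linear:
  assumes "v \<in> carrier_vec d" "w \<in> carrier_vec d"
  shows "coeffs_of_vec (v + w) = coeffs_of_vec v + coeffs_of_vec w"
    and "coeffs_of_vec (v - w) = coeffs_of_vec v - coeffs_of_vec w"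
  using assms by (auto intro!: poly_mapping_eqI
    simp: lookup_coeffs_of_vec lookup_add lookup_minus)

lemma coeffs_of_vec_smult: "coeffs_of_vec (complex_of_real r \<cdot>\<^sub>v v) = r *\<^sub>R coeffs_of_vec v"
  by (rule poly_mapping_eqI) (simp add: lookup_coeffs_of_vec lookup_scaleR scaleR_conv_of_real)

lemma inner_product_onD:
  assumes "inner_product_on d ip" "x \<in> carrier_vec d" "y \<in> carrier_vec d" 
  shows "z \<in> carrier_vec d \<Longrightarrow> ip (x + y) z = ip x z + ip y z"
    and "z \<in> carrier_vec d \<Longrightarrow> ip z (x + y) = ip z x + ip z y"
    and "ip (c \<cdot>\<^sub>v x) y = c * ip x y"
    and "ip x (c \<cdot>\<^sub>v y) = cnj c * ip x y"
    and "ip y x = cnj (ip x y)"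
proof -
  show add: "ip (x + y) z = ip x z + ip y z" if "z \<in> carrier_vec d" for z
    using assms that unfolding inner_product_on_def by blast
  have herm: "ip b a = cnj (ip a b)" if "a \<in> carrier_vec d" "b \<in> carrier_vec d" for a b
    using assms that unfolding inner_product_on_def by blast
  have scale: "ip (c \<cdot>\<^sub>v a) b = c * ip a b" if "a \<in> carrier_vec d" "b \<in> carrier_vec d" for a b
    using assms that unfolding inner_product_on_def by blast
  show "ip z (x + y) = ip z x + ip z y" if z: "z \<in> carrier_vec d"
    using add[OF z] herm[of "x + y" z] herm[of x z] herm[of y z] assms z by simp
  show "ip (c \<cdot>\<^sub>v x) y = c * ip x y" by (rule scale[OF assms(2,3)])
  show "ip x (c \<cdot>\<^sub>v y) = cnj c * ip x y"
    using scale[OF assms(3,2)] herm[of "c \<cdot>\<^sub>v y" x] herm[of y x] assms by simp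
  show "ip y x = cnj (ip x y)" by (rule herm[OF assms(2,3)])
qed

lemma inner_product_on_nonneg:
  assumes "inner_product_on d ip" "x \<in> carrier_vec d"
  shows "0 \<le> ip x x"
proof (cases "x = 0\<^sub>v d")
  case True
  have "ip (0 \<cdot>\<^sub>v x) x = 0" using inner_product_onD(3)[OF assms assms(2), of 0] by simp
  moreover have "0 \<cdot>\<^sub>v x = x" using True by auto
  ultimately show ?thesis by simp
next
  case False
  then have "0 < ip x x" using assms unfolding inner_product_on_def by blast
  then show ?thesis by (rule less_imp_le)
qed

context
  fixes n d :: nat and R :: "(nat \<Rightarrow> nat) \<Rightarrow> complex mat" and ip :: "complex vec \<Rightarrow> complex vec \<Rightarrow> complex"
  assumes rep: "complex_rep (sym_group n) d R"
    and ip: "inner_product_on d ip"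
    and unitary: "unitary_rep_wrt (sym_group n) d ip R"
begin

lemma rep_carrier: "p permutes {1..n} \<Longrightarrow> R p \<in> carrier_mat d d"
  using complex_repD(1)[OF rep] by (simp add: sym_group_carrier)

lemma rep_mult_vec [simp]: "p permutes {1..n} \<Longrightarrow> x \<in> carrier_vec d \<Longrightarrow> R p *\<^sub>v x \<in> carrier_vec d"
  by (rule mult_mat_vec_carrier[OF rep_carrier])

lemma rep_comp:
  assumes "p permutes {1..n}" "q permutes {1..n}" "x \<in> carrier_vec d"
  shows "R (p \<circ> q) *\<^sub>v x = R p *\<^sub>v (R q *\<^sub>v x)"
  using complex_repD(2)[OF rep, of p q] assms rep_carrier
  by (simp add: sym_group_carrier sym_group_mult assoc_mult_mat_vec[of _ d d _ d])

text \<open>Homomorphisms of groups preserve the identity; here this follows from injectivity of the matrices, as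
  \<open>R id\<close> annihilates \<open>R id x - x\<close>.\<close>

lemma rep_id:
  assumes x: "x \<in> carrier_vec d"
  shows "R id *\<^sub>v x = x"
proof -
  have id: "id permutes {1..n}" by (rule permutes_id)
  have Rx: "R id *\<^sub>v x \<in> carrier_vec d" by (rule rep_mult_vec[OF id x])
  have "R id *\<^sub>v (R id *\<^sub>v x - x) = R id *\<^sub>v (R id *\<^sub>v x) - R id *\<^sub>v x"
    by (rule mult_minus_distrib_mat_vec[OF rep_carrier[OF id] Rx x])
  also have "R id *\<^sub>v (R id *\<^sub>v x) = R id *\<^sub>v x"
    using rep_comp[OF id id x] unfolding comp_id by (rule sym)
  also have "R id *\<^sub>v x - R id *\<^sub>v x = 0\<^sub>v d" by (rule minus_cancel_vec[OF Rx])
  finally have zero: "R id *\<^sub>v (R id *\<^sub>v x - x) = 0\<^sub>v d" .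
  have "id \<in> carrier (sym_group n)" using id by (simp only: sym_group_carrier)
  then have "R id *\<^sub>v x - x = 0\<^sub>v d"
    by (rule complex_repD(3)[OF rep, of id "R id *\<^sub>v x - x", OF _ minus_carrier_vec[OF Rx x] zero])
  then have "(R id *\<^sub>v x - x) $ i = 0" if "i < d" for i using that by simp
  then show ?thesis using rep_carrier[OF id] x by (intro eq_vecI) auto
qed

text \<open>The representation acts on the first \<open>d\<close> coordinates; the remaining ones are left alone, so that the identity
  permutation acts as the identity.\<close>

definition coeff_act :: "(nat \<Rightarrow> nat) \<Rightarrow> (nat \<Rightarrow>\<^sub>0 complex) \<Rightarrow> (nat \<Rightarrow>\<^sub>0 complex)" where
  "coeff_act p f = f + (coeffs_of_vec (R p *\<^sub>v vec_of_coeffs d f) - coeffs_of_vec (vec_of_coeffs d f))"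

lemma vec_of_coeff_act:
  assumes "p permutes {1..n}"
  shows "vec_of_coeffs d (coeff_act p f) = R p *\<^sub>v vec_of_coeffs d f"
proof (rule eq_vecI)
  have "dim_vec (R p *\<^sub>v vec_of_coeffs d f) = d"
    using rep_carrier[OF assms] by auto
  then show "vec_of_coeffs d (coeff_act p f) $ i = (R p *\<^sub>v vec_of_coeffs d f) $ i"
     if "i < dim_vec (R p *\<^sub>v vec_of_coeffs d f)" for i
    using that by (simp add: vec_of_coeffs_def coeff_act_def lookup_add lookup_minus lookup_coeffs_of_vec
      del: index_mult_mat_vec)
  show "dim_vec (vec_of_coeffs d (coeff_act p f)) = dim_vec (R p *\<^sub>v vec_of_coeffs d f)"
    using rep_carrier[OF assms] by (simp add: vec_of_coeffs_def)
qed

definition coeff_ip :: "(nat \<Rightarrow>\<^sub>0 complex) \<Rightarrow> (nat \<Rightarrow>\<^sub>0 complex) \<Rightarrow> real" where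
  "coeff_ip f g = Re (ip (vec_of_coeffs d f) (vec_of_coeffs d g))"

lemma coeff_action_isometric: "isometric_permutation_action {1..n} coeff_act coeff_ip"
proof (rule isometric_permutation_action.intro)
  fix p q :: "nat \<Rightarrow> nat" and f g :: "nat \<Rightarrow>\<^sub>0 complex"
  note D = inner_product_onD[OF ip]
  show "linear (coeff_act p)" if p: "p permutes {1..n}"
    using p rep_carrier[OF p]
    by (intro linearI) (simp_all add: coeff_act_def vec_of_coeffs_linear mult_add_distrib_mat_vec[of _ d d]
      mult_mat_vec[of _ d d] coeffs_of_vec_linear[of _ d] coeffs_of_vec_smult algebra_simps)
  show "coeff_act id f = f" using rep_id[of "vec_of_coeffs d f"] by (simp add: coeff_act_def)
  show "coeff_act (p \<circ> q) f = coeff_act p (coeff_act q f)"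
    if p: "p permutes {1..n}" and q: "q permutes {1..n}"
    unfolding coeff_act_def[of "p \<circ> q"] coeff_act_def[of p] vec_of_coeff_act[OF q]
    by (simp add: rep_comp[OF p q] coeff_act_def)
  show "bilinear coeff_ip"
    unfolding bilinear_def
    by (intro conjI allI linearI) (simp_all add: coeff_ip_def vec_of_coeffs_linear D(1-4))
  show "coeff_ip f g = coeff_ip g f"
    using D(5)[of "vec_of_coeffs d f" "vec_of_coeffs d g"] by (simp add: coeff_ip_def)
  show "coeff_ip f f \<ge> 0"
    using inner_product_on_nonneg[OF ip, of "vec_of_coeffs d f"] by (simp add: coeff_ip_def less_eq_complex_def)
  show "coeff_ip (coeff_act p f) (coeff_act p g) = coeff_ip f g" if p: "p permutes {1..n}"
    using unitary p unfolding coeff_ip_def vec_of_coeff_act[OF p] unitary_rep_wrt_def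
    by (simp add: sym_group_carrier)
qed

lemma octopus_unitary:
  fixes a :: "nat \<Rightarrow> real"
  assumes n: "n \<ge> 1" and a: "\<And>i. 1 \<le> i \<Longrightarrow> i < n \<Longrightarrow> a i \<ge> 0" and x: "x \<in> carrier_vec d"
  defines "\<phi> i k \<equiv> Re (ip x x - ip (R (Transposition.transpose i k) *\<^sub>v x) x)"
  shows "(\<Sum>i = 1..n - 1. \<Sum>k = 1..n - 1. a i * a k * \<phi> i k) \<le> 2 * (\<Sum>i = 1..n - 1. a i) * (\<Sum>i = 1..n - 1. a i * \<phi> i n)"
proof -
  interpret isometric_permutation_action "{1..n}" coeff_act coeff_ip by (rule coeff_action_isometric)
  have ins: "{1..n} = insert n {1..n-1}" using n by auto
  have \<phi>: "coeff_ip (coeffs_of_vec x) (coeffs_of_vec x) - coeff_ip (tr i k (coeffs_of_vec x)) (coeffs_of_vec x) = \<phi> i k"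
    if "i \<in> {1..n}" "k \<in> {1..n}" for i k
    using transpose_permutes[OF that]
    by (simp add: coeff_ip_def tr_def vec_of_coeff_act vec_of_coeffs_of_vec[OF x] \<phi>_def)
  have "(\<Sum>i = 1..n - 1. \<Sum>k = 1..n - 1. a i * a k * \<phi> i k) = (\<Sum>i = 1..n - 1. \<Sum>k = 1..n - 1. a i * a k * 
     (coeff_ip (coeffs_of_vec x) (coeffs_of_vec x) - coeff_ip (tr i k (coeffs_of_vec x)) (coeffs_of_vec x)))"
    using n by (intro sum.cong refl) (subst \<phi>, auto)
  also have "\<dots> \<le> 2 * (\<Sum>i = 1..n - 1. a i) * (\<Sum>i = 1..n - 1. a i *
     (coeff_ip (coeffs_of_vec x) (coeffs_of_vec x) - coeff_ip (tr i n (coeffs_of_vec x)) (coeffs_of_vec x)))"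
    by (rule octopus_inequality[OF _ _ ins]) (use n a in auto)
  also have "(\<Sum>i = 1..n - 1. a i *
     (coeff_ip (coeffs_of_vec x) (coeffs_of_vec x) - coeff_ip (tr i n (coeffs_of_vec x)) (coeffs_of_vec x)))
     = (\<Sum>i = 1..n - 1. a i * \<phi> i n)"
    using n by (intro sum.cong refl) (subst \<phi>, auto)
  finally show ?thesis .
qed

lemma ip_rep_laplacian:
  assumes x: "x \<in> carrier_vec d" and y: "y \<in> carrier_vec d"
  shows "rep_laplacian (sym_group n) d w R *\<^sub>v x \<in> carrier_vec d"
    and "ip (rep_laplacian (sym_group n) d w R *\<^sub>v x) y
      = (\<Sum>g\<in>carrier (sym_group n). Poly_Mapping.lookup w g * (ip x y - ip (R g *\<^sub>v x) y))"
proof -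
  interpret M: abelian_group "module_mat TYPE(complex) d d" by (rule abelian_group_mat)
  note D = inner_product_onD[OF ip]
  let ?f = "\<lambda>g. Poly_Mapping.lookup w g \<cdot>\<^sub>m (1\<^sub>m d - R g)"
  have "(\<Oplus>\<^bsub>module_mat TYPE(complex) d d\<^esub> g\<in>A. ?f g) \<in> carrier_mat d d \<and>
    ip ((\<Oplus>\<^bsub>module_mat TYPE(complex) d d\<^esub> g\<in>A. ?f g) *\<^sub>v x) y
      = (\<Sum>g\<in>A. Poly_Mapping.lookup w g * (ip x y - ip (R g *\<^sub>v x) y))"
    if "finite A" "A \<subseteq> carrier (sym_group n)" for A
    using that
  proof (induction A rule: finite_induct)
    case empty
    have "ip (0\<^sub>m d d *\<^sub>v x) y = ip (0 \<cdot>\<^sub>v x) y" using x by (intro arg_cong[of _ _ "\<lambda>u. ip u y"]) auto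
    also have "\<dots> = 0" by (simp add: D(3)[OF x y])
    finally show ?case by (simp add: module_mat_simps)
  next
    case (insert g A)
    have g: "R g \<in> carrier_mat d d" using insert.prems rep_carrier by (simp add: sym_group_carrier)
    let ?S = "(\<Oplus>\<^bsub>module_mat TYPE(complex) d d\<^esub> g\<in>A. ?f g)"
    have IH: "?S \<in> carrier_mat d d" "ip (?S *\<^sub>v x) y 
       = (\<Sum>g\<in>A. Poly_Mapping.lookup w g * (ip x y - ip (R g *\<^sub>v x) y))" using insert by auto
    have f: "?f h \<in> carrier_mat d d" if "h \<in> insert g A" for h
    proof -
      have "h permutes {1..n}" using that insert.prems unfolding sym_group_carrier[symmetric] by blast
      then show ?thesis by (intro smult_carrier_mat minus_carrier_mat rep_carrier)
    qed
    have eq: "(\<Oplus>\<^bsub>module_mat TYPE(complex) d d\<^esub> g\<in>insert g A. ?f g) = ?f g + ?S"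
      using M.finsum_insert[OF insert.hyps, of ?f] f by (simp add: module_mat_simps Pi_def)
    have gx: "R g *\<^sub>v x \<in> carrier_vec d" using g x by simp
    have "?f g *\<^sub>v x = Poly_Mapping.lookup w g \<cdot>\<^sub>v (x + (-1) \<cdot>\<^sub>v (R g *\<^sub>v x))"
    proof (rule eq_vecI)
      fix i assume "i < dim_vec (Poly_Mapping.lookup w g \<cdot>\<^sub>v (x + (-1) \<cdot>\<^sub>v (R g *\<^sub>v x)))"
      then have i: "i < d" using g by simp
      have "((1\<^sub>m d - R g) *\<^sub>v x) $ i = x $ i - (R g *\<^sub>v x) $ i"
        using minus_mult_distrib_mat_vec[OF one_carrier_mat g x] g x i by simp
      then show "(?f g *\<^sub>v x) $ i = (Poly_Mapping.lookup w g \<cdot>\<^sub>v (x + (-1) \<cdot>\<^sub>v (R g *\<^sub>v x))) $ i"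
        using g x i by simp
    qed (use g in simp)
    then have "ip (?f g *\<^sub>v x) y = Poly_Mapping.lookup w g * (ip x y - ip (R g *\<^sub>v x) y)"
      using D(1)[OF x, of "(-1) \<cdot>\<^sub>v (R g *\<^sub>v x)" y] D(3)[OF gx y] D(3)[of "x + (-1) \<cdot>\<^sub>v (R g *\<^sub>v x)" y] gx x y by simp
    moreover have "(?f g + ?S) *\<^sub>v x = ?f g *\<^sub>v x + ?S *\<^sub>v x"
      using f[of g] by (intro add_mult_distrib_mat_vec[OF _ IH(1) x]) auto
    moreover have "ip (?f g *\<^sub>v x + ?S *\<^sub>v x) y = ip (?f g *\<^sub>v x) y + ip (?S *\<^sub>v x) y"
      using f[of g] IH(1) x y by (intro D(1)) auto
    ultimately show ?case unfolding eq using f[of g] IH insert.hyps by simp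
  qed
  from this[of "carrier (sym_group n)"]
  show "rep_laplacian (sym_group n) d w R *\<^sub>v x \<in> carrier_vec d"
    and "ip (rep_laplacian (sym_group n) d w R *\<^sub>v x) y
      = (\<Sum>g\<in>carrier (sym_group n). Poly_Mapping.lookup w g * (ip x y - ip (R g *\<^sub>v x) y))"
    using x by (auto simp: rep_laplacian_def sym_group_def finite_permutations)
qed

lemma ip_transposition_adjoint:
  assumes x: "x \<in> carrier_vec d" and y: "y \<in> carrier_vec d" and ik: "i \<in> {1..n}" "k \<in> {1..n}"
  shows "ip (R (Transposition.transpose i k) *\<^sub>v x) y = ip x (R (Transposition.transpose i k) *\<^sub>v y)"
proof -
  let ?t = "Transposition.transpose i k"
  have t: "?t permutes {1..n}" using ik by (rule permutes_swap_id)
  have "R ?t *\<^sub>v (R ?t *\<^sub>v y) = y"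
    unfolding rep_comp[OF t t y, symmetric] transpose_comp_involutory by (rule rep_id[OF y])
  moreover have "ip (R ?t *\<^sub>v x) (R ?t *\<^sub>v (R ?t *\<^sub>v y)) = ip x (R ?t *\<^sub>v y)"
    using unitary[unfolded unitary_rep_wrt_def, rule_format, of ?t x "R ?t *\<^sub>v y"] t x rep_mult_vec[OF t y]
    unfolding sym_group_carrier by blast
  ultimately show ?thesis by simp
qed

end

section \<open>Sums of transpositions in the group algebra\<close>

definition pairs :: "nat \<Rightarrow> (nat \<times> nat) set" where
  "pairs m = {(i, k). 1 \<le> i \<and> i < k \<and> k \<le> m}"

lemma finite_pairs: "finite (pairs m)"
  by (rule finite_subset[of _ "{..m} \<times> {..m}"]) (auto simp: pairs_def)

lemma sum_pairs_Suc:
  "(\<Sum>(i, k)\<in>pairs (Suc m). f i k) = (\<Sum>(i, k)\<in>pairs m. f i k) + (\<Sum>i = 1..m. f i (Suc m))"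
proof -
  have "pairs (Suc m) = pairs m \<union> (\<lambda>i. (i, Suc m)) ` {1..m}"
    by (auto simp: pairs_def image_iff le_Suc_eq)
  moreover have "pairs m \<inter> (\<lambda>i. (i, Suc m)) ` {1..m} = {}" by (auto simp: pairs_def)
  ultimately show ?thesis
    by (simp add: sum.union_disjoint finite_pairs sum.reindex inj_on_def)
qed

lemma sum_square_eq_pairs:
  fixes f :: "nat \<Rightarrow> nat \<Rightarrow> real"
  assumes "\<And>i. f i i = 0" "\<And>i k. f i k = f k i"
  shows "(\<Sum>i = 1..m. \<Sum>k = 1..m. f i k) = 2 * (\<Sum>(i, k)\<in>pairs m. f i k)"
proof (induction m)
  case 0
  have "pairs 0 = {}" by (auto simp: pairs_def)
  then show ?case by simp
next
  case (Suc m)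
  have "(\<Sum>k = 1..m. f (Suc m) k) = (\<Sum>i = 1..m. f i (Suc m))" using assms(2) by (intro sum.cong) auto
  then show ?case using Suc by (simp add: sum_pairs_Suc sum.distrib assms(1))
qed

lemma transposition_sum_eq:
  "transposition_sum m c = (\<Sum>(i, k)\<in>pairs m. 
     Poly_Mapping.single (Transposition.transpose i k) (complex_of_real (c i k)))"
  by (simp add: transposition_sum_def pairs_def)

lemma pairs_transpose:
  assumes "m \<le> n" "(i, k) \<in> pairs m"
  shows "i \<in> {1..n}" "k \<in> {1..n}" "Transposition.transpose i k \<in> carrier (sym_group n)"
  using assms by (auto simp: pairs_def sym_group_carrier intro!: permutes_swap_id)

lemma sum_transposition_sum:
  assumes "m \<le> n"
  shows "(\<Sum>g\<in>carrier (sym_group n). Poly_Mapping.lookup (transposition_sum m c) g * F g)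
    = (\<Sum>(i, k)\<in>pairs m. complex_of_real (c i k) * F (Transposition.transpose i k))"
proof -
  have fin: "finite (carrier (sym_group n))" by (simp add: sym_group_def finite_permutations)
  have "(\<Sum>g\<in>carrier (sym_group n). Poly_Mapping.lookup (transposition_sum m c) g * F g)
    = (\<Sum>(i, k)\<in>pairs m. \<Sum>g\<in>carrier (sym_group n). 
        (if g = Transposition.transpose i k then complex_of_real (c i k) * F g else 0))"
    unfolding case_prod_unfold
    by (subst sum.swap) (auto simp: transposition_sum_eq lookup_sum lookup_single when_def case_prod_unfold
      sum_distrib_right intro!: sum.cong)
  also have "\<dots> = (\<Sum>(i, k)\<in>pairs m. complex_of_real (c i k) * F (Transposition.transpose i k))"
    using pairs_transpose(3)[OF assms] by (intro sum.cong) (auto simp: fin)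
  finally show ?thesis .
qed

lemma symmetric_elements_closed:
  assumes "v \<in> symmetric_elements G" "w \<in> symmetric_elements G"
  shows "v + w \<in> symmetric_elements G" "v - w \<in> symmetric_elements G"
proof -
  have "star G (v + w) = star G v + star G w" "star G (v - w) = star G v - star G w"
    by (simp_all add: star_def lookup_add lookup_minus single_add single_diff sum.distrib sum_subtractf)
  then show "v + w \<in> symmetric_elements G" "v - w \<in> symmetric_elements G"
    using assms keys_diff[of v w] keys_add[of v w]
    by (auto simp: symmetric_elements_def group_algebra_def)
qed

lemma involution_in_symmetric_elements:
  assumes G: "group G" "finite (carrier G)" and t: "t \<in> carrier G" "t \<otimes>\<^bsub>G\<^esub> t = \<one>\<^bsub>G\<^esub>"
  shows "Poly_Mapping.single t (complex_of_real c) \<in> symmetric_elements G"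
proof -
  have inv: "inv\<^bsub>G\<^esub> t = t" by (rule group.inv_equality[OF G(1) t(2) t(1) t(1)])
  have "star G (Poly_Mapping.single t (complex_of_real c))
    = (\<Sum>g\<in>carrier G. if g = t then Poly_Mapping.single (inv\<^bsub>G\<^esub> t) (complex_of_real c) else 0)"
    unfolding star_def by (intro sum.cong refl) (simp add: lookup_single when_def)
  also have "\<dots> = Poly_Mapping.single t (complex_of_real c)" using G(2) t(1) by (simp add: inv)
  finally show ?thesis using t(1) by (simp add: symmetric_elements_def group_algebra_def)
qed

lemma transposition_sum_symmetric:
  assumes "m \<le> n"
  shows "transposition_sum m c \<in> symmetric_elements (sym_group n)"
proof -
  have fin: "finite (carrier (sym_group n))" by (simp add: sym_group_def finite_permutations)
  have "(\<Sum>(i, k)\<in>P. Poly_Mapping.single (Transposition.transpose i k) (complex_of_real (c i k)))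
      \<in> symmetric_elements (sym_group n)" if "finite P" "P \<subseteq> pairs m" for P
    using that
  proof (induction P rule: finite_induct)
    case empty
    then show ?case by (simp add: symmetric_elements_def group_algebra_def star_def)
  next
    case (insert e P)
    obtain i k where e: "e = (i, k)" by force
    have t: "Transposition.transpose i k \<in> carrier (sym_group n)"
      using pairs_transpose(3)[OF assms, of i k] insert.prems e by simp
    have "Poly_Mapping.single (Transposition.transpose i k) (complex_of_real (c i k))
        \<in> symmetric_elements (sym_group n)"
      by (rule involution_in_symmetric_elements[OF sym_group_is_group fin t])
        (simp add: sym_group_mult sym_group_one)
    then show ?case using insert by (simp add: e symmetric_elements_closed(1))
  qed
  then show ?thesis unfolding transposition_sum_eq using finite_pairs by blast
qed

section \<open>Positivity of the octopus element\<close>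

theorem theorem4p2:
  fixes n :: nat and w :: "nat \<Rightarrow> nat \<Rightarrow> real"
  assumes "n \<ge> 3"
    and "\<And>i k. 1 \<le> i \<Longrightarrow> i < k \<Longrightarrow> k \<le> n \<Longrightarrow> w i k \<ge> 0"
    and "(\<Sum>j = 1..n - 1. w j n) > 0"
  shows "transposition_sum n w - theta n w \<in> Gamma (sym_group n)"
proof -
  let ?G = "sym_group n" and ?t = "Transposition.transpose :: nat \<Rightarrow> nat \<Rightarrow> nat \<Rightarrow> nat"
  define s where "s = (\<Sum>j = 1..n - 1. w j n)"
  define v where "v i k = w i k + w i n * w k n / s" for i k
  define E where "E = transposition_sum n w - transposition_sum (n - 1) v"
  have E: "transposition_sum n w - theta n w = E" by (simp add: E_def theta_def v_def[abs_def] s_def)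
  have "psd_wrt d ip (rep_laplacian ?G d E R)"
    if irr: "irreducible_rep ?G d R" and ip: "inner_product_on d ip" and un: "unitary_rep_wrt ?G d ip R"
    for d R ip
  proof -
    let ?L = "rep_laplacian ?G d E R"
    have rep: "complex_rep ?G d R" using irr by (simp add: irreducible_rep_def)
    define F where "F x y i k = ip x y - ip (R (?t i k) *\<^sub>v x) y" for x y i k
    have form: "ip (?L *\<^sub>v x) y = (\<Sum>(i, k)\<in>pairs n. complex_of_real (w i k) * F x y i k)
        - (\<Sum>(i, k)\<in>pairs (n - 1). complex_of_real (v i k) * F x y i k)"
      if "x \<in> carrier_vec d" "y \<in> carrier_vec d" for x y
      unfolding ip_rep_laplacian(2)[OF rep ip un that] E_def lookup_minus left_diff_distrib sum_subtractf F_def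
      by (simp add: sum_transposition_sum)
    have cnjF: "cnj (F y x i k) = F x y i k"
      if xy: "x \<in> carrier_vec d" "y \<in> carrier_vec d" and "(i, k) \<in> pairs m" "m \<le> n" for x y i k m
    proof -
      have ik: "i \<in> {1..n}" "k \<in> {1..n}" using pairs_transpose that by blast+
      have "?t i k permutes {1..n}" using ik by (rule permutes_swap_id)
      from rep_mult_vec[OF rep ip un this xy(2)] 
      have "cnj (ip (R (?t i k) *\<^sub>v y) x) = ip x (R (?t i k) *\<^sub>v y)"
        using inner_product_onD(5)[OF ip _ xy(1)] by simp
      also have "\<dots> = ip (R (?t i k) *\<^sub>v x) y"
        by (rule ip_transposition_adjoint[OF rep ip un xy ik, symmetric])
      finally show ?thesis using inner_product_onD(5)[OF ip xy(2,1)] by (simp add: F_def)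
    qed
    have adj: "ip (?L *\<^sub>v x) y = ip x (?L *\<^sub>v y)"
      if xy: "x \<in> carrier_vec d" "y \<in> carrier_vec d" for x y
    proof -
      have "ip x (?L *\<^sub>v y) = cnj (ip (?L *\<^sub>v y) x)"
        by (rule inner_product_onD(5)[OF ip ip_rep_laplacian(1)[OF rep ip un xy(2,2)] xy(1)])
      also have "\<dots> = (\<Sum>(i, k)\<in>pairs n. complex_of_real (w i k) * cnj (F y x i k))
        - (\<Sum>(i, k)\<in>pairs (n - 1). complex_of_real (v i k) * cnj (F y x i k))"
        unfolding form[OF xy(2,1)] by (simp add: case_prod_unfold)
      also have "\<dots> = ip (?L *\<^sub>v x) y"
        unfolding form[OF xy]
        by (intro arg_cong2[of _ _ _ _ "(-)"] sum.cong refl) (auto simp: cnjF[OF xy])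
      finally show ?thesis by simp
    qed
    have pos: "0 \<le> ip (?L *\<^sub>v x) x" if x: "x \<in> carrier_vec d" for x
    proof -
      define \<phi> where "\<phi> i k = Re (F x x i k)" for i k
      have \<phi>0: "\<phi> i i = 0" for i
        using rep_id[OF rep ip un x] by (simp add: \<phi>_def F_def)
      have \<phi>sym: "\<phi> i k = \<phi> k i" for i k by (simp add: \<phi>_def F_def Transposition.transpose_commute)
      have n: "Suc (n - 1) = n" using assms(1) by simp
      have "Re (ip (?L *\<^sub>v x) x) = (\<Sum>(i, k)\<in>pairs n. w i k * \<phi> i k) - (\<Sum>(i, k)\<in>pairs (n - 1). v i k * \<phi> i k)"
        unfolding form[OF x x] by (simp add: case_prod_unfold \<phi>_def)
      also have "\<dots> = (\<Sum>i = 1..n - 1. w i n * \<phi> i n)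
         + ((\<Sum>(i, k)\<in>pairs (n - 1). w i k * \<phi> i k) - (\<Sum>(i, k)\<in>pairs (n - 1). v i k * \<phi> i k))"
        using sum_pairs_Suc[of "\<lambda>i k. w i k * \<phi> i k" "n - 1"] unfolding n by simp
      also have "(\<Sum>(i, k)\<in>pairs (n - 1). w i k * \<phi> i k) - (\<Sum>(i, k)\<in>pairs (n - 1). v i k * \<phi> i k)
         = - (\<Sum>(i, k)\<in>pairs (n - 1). w i n * w k n * \<phi> i k) / s"
        by (simp add: v_def case_prod_unfold sum_subtractf[symmetric] sum_divide_distrib sum_negf[symmetric]
          algebra_simps)
      also have "(\<Sum>(i, k)\<in>pairs (n - 1). w i n * w k n * \<phi> i k)
         = (\<Sum>i = 1..n - 1. \<Sum>k = 1..n - 1. w i n * w k n * \<phi> i k) / 2"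
        by (subst sum_square_eq_pairs) (simp_all add: \<phi>0 \<phi>sym mult_ac)
      finally have Re: "Re (ip (?L *\<^sub>v x) x) = (\<Sum>i = 1..n - 1. w i n * \<phi> i n)
         - (\<Sum>i = 1..n - 1. \<Sum>k = 1..n - 1. w i n * w k n * \<phi> i k) / (2 * s)" by simp
      have "(\<Sum>i = 1..n - 1. \<Sum>k = 1..n - 1. w i n * w k n * \<phi> i k) \<le> 2 * s * (\<Sum>i = 1..n - 1. w i n * \<phi> i n)"
        using octopus_unitary[OF rep ip un _ _ x, of "\<lambda>i. w i n"] assms(1,2)
        unfolding s_def \<phi>_def F_def by simp
      moreover have "s > 0" using assms(3) by (simp add: s_def)
      ultimately have "0 \<le> Re (ip (?L *\<^sub>v x) x)" unfolding Re by (simp add: field_simps)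
      moreover have "Im (ip (?L *\<^sub>v x) x) = 0"
      proof -
        have "ip (?L *\<^sub>v x) x = cnj (ip (?L *\<^sub>v x) x)"
          using adj[OF x x] inner_product_onD(5)[OF ip ip_rep_laplacian(1)[OF rep ip un x x] x] by simp
        then show ?thesis by (simp add: complex_eq_iff)
      qed
      ultimately show ?thesis by (simp add: less_eq_complex_def)
    qed
    show ?thesis unfolding psd_wrt_def using adj pos by blast
  qed
  moreover have "E \<in> symmetric_elements ?G"
    unfolding E_def by (intro symmetric_elements_closed(2) transposition_sum_symmetric) auto
  ultimately show ?thesis unfolding E Gamma_def by blast
qed

end
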